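(* Let $\{\beta^k\}_{k\ge 0}$ be a nondecreasing sequence of positive reals with $\sum_{k=0}^{+\infty}\frac{1}{\beta^k}=+\infty$. Suppose that the sequences $\{(\mathcal{X}^k,\mathcal{Y}_1^k,\ldots,\mathcal{Y}_N^k)\}$ and $\{(\Lambda_1^k,\ldots,\Lambda_N^k)\}$ are generated by SALM with penalty parameters $\{\beta^k\}$, and that the optimality system (KKT) has at least one solution. Then the sequence $\{(\mathcal{X}^k,\mathcal{Y}^k_1,\ldots,\mathcal{Y}^k_N)\}$ converges to an optimal solution of problem (P), that is, of $$\min_{\mathcal{X},\mathcal{Y}_1,\ldots,\mathcal{Y}_N\in\mathcal{T}}\ f(\mathcal{X})+\sum_{i=1}^N\|Y_{i,(i)}\|_*\quad\text{s.t.}\quad \mathcal{Y}_i=\mathcal{X},\ i=1,\ldots,N,$$ and hence to an optimal solution of $\min \sum_{i=1}^N\|Y_{i,(i)}\|_*$ subject to $\mathcal{Y}_i=\mathcal{X}$ for all $i$, $\mathcal{Y}_i\in\mathcal{T}$, $\mathcal{X}\in\mathcal{B}$.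
   Context: Tensors. $\mathcal{T}=\mathbb{R}^{n_1\times\cdots\times n_N}$ is the space of real $N$-way tensors, with entrywise inner product $\langle\cdot,\cdot\rangle$ and Frobenius norm $\|\cdot\|_F$. For $\mathcal{Z}\in\mathcal{T}$, the mode-$i$ unfolding $Z_{(i)}\in\mathbb{R}^{n_i\times J_i}$, $J_i=\prod_{k\neq i}n_k$, is the matrix in which the entry of $\mathcal{Z}$ at $(i_1,\ldots,i_N)$ is placed at position $(i_i,j)$ (row index = the $i$-th tensor index), $j=1+\sum_{k\ne i}(i_k-1)\prod_{m<k,\,m\neq i}n_m$; $\mathrm{refold}_i$ is the inverse of this map. For a tensor $\mathcal{Y}_i$ (or $\Lambda_i$), $Y_{i,(m)}$ (or $\Lambda_{i,(m)}$) denotes its mode-$m$ unfolding. $\|\cdot\|_*$ is the matrix nuclear norm (sum of singular values). Problem. $\mathscr{A}:\mathcal{T}\to\mathbb{R}^p$ ($p\le\prod_i n_i$) is a linear map, $\mathbf{b}\in\mathbb{R}^p$, $\mathcal{B}=\{\mathcal{X}\in\mathcal{T}:\mathscr{A}(\mathcal{X})=\mathbf{b}\}$, and $f(\mathcal{X})=0$ if $\mathcal{X}\in\mathcal{B}$, $+\infty$ otherwise. Problem (P) is: minimize $f(\mathcal{X})+\sum_{i=1}^N\|Y_{i,(i)}\|_*$ over $\mathcal{X},\mathcal{Y}_1,\ldots,\mathcal{Y}_N\in\mathcal{T}$ subject to $\mathcal{Y}_i=\mathcal{X}$ for $i=1,\ldots,N$. Optimality system (KKT) for $(\mathcal{X}^*,\mathcal{Y}_1^*,\ldots,\mathcal{Y}_N^*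 )$ and Lagrange multipliers $(\Lambda_1^*,\ldots,\Lambda_N^* )\in\mathcal{T}^N$: $\mathcal{X}^*\in\mathcal{B}$, $\sum_{i=1}^N\Lambda_i^*\in N_{\mathcal{B}}(\mathcal{X}^* )$; $-\Lambda_i^*\in\partial h_i(\mathcal{Y}_i^* )$ and $\mathcal{X}^*=\mathcal{Y}_i^*$ for all $i$. Here $h_i(\mathcal{Z})=\|Z_{(i)}\|_*$, $\partial$ is the convex subdifferential, and $N_{\mathcal{B}}(\mathcal{X})=\{\mathcal{Z}\in\mathcal{T}:\langle\mathcal{Z},\mathcal{X}'-\mathcal{X}\rangle\le0\ \forall\mathcal{X}'\in\mathcal{B}\}$ for $\mathcal{X}\in\mathcal{B}$, $N_{\mathcal{B}}(\mathcal{X})=\emptyset$ otherwise. Algorithm SALM. Given positive penalty parameters $\{\beta^k\}_{k\ge0}$ (superscripts on $\beta$ are indices) and starting tensors $\mathcal{Y}_i^0,\Lambda_i^0\in\mathcal{T}$ ($i=1,\ldots,N$), iterate for $k=0,1,2,\ldots$: (1) $\mathcal{X}^{k+1}=\mathcal{P}_{\mathcal{B}}\Big(\frac{1}{N\beta^k}\big[\sum_{i=1}^N\Lambda_i^k+\sum_{i=1}^N\beta^k\mathcal{Y}_i^k\big]\Big)$, with $\mathcal{P}_{\mathcal{B}}$ the orthogonal projection onto $\mathcal{B}$ in the Frobenius norm; (2) $\mathcal{Y}_i^{k+1}=\mathrm{refold}_i\Big(\mathcal{D}_{1/\beta^k}\big(X^{k+1}_{(i)}-\frac{1}{\beta^k}\Lambda^k_{i,(i)}\big)\Big)$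 for $i=1,\ldots,N$; (3) $\Lambda_i^{k+1}=\Lambda_i^k-\beta^k(\mathcal{X}^{k+1}-\mathcal{Y}_i^{k+1})$ for $i=1,\ldots,N$. Here, for $\tau>0$ and a matrix with singular value decomposition $X=U\,\mathrm{Diag}(\sigma)V^\top$, $\mathcal{D}_\tau(X)=U\,\mathrm{Diag}(\max\{\sigma_j-\tau,0\})V^\top$. *)

theory Defs
  imports
    Complex_Main
    "HOL-Library.FuncSet"
    "HOL-Library.Extended_Real"
    "Jordan_Normal_Form.Matrix"
begin

text \<open>
  The shape \<open>d = [n_1, ..., n_N]\<close> lists the dimensions, so \<open>N = length d\<close>. Modes and indices are
  counted from 0, as in \<open>Jordan_Normal_Form.Matrix\<close>: the modes are \<open>0, ..., N - 1\<close> and the index of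
  mode \<open>k\<close> ranges over \<open>0, ..., d ! k - 1\<close>. A tensor is a function on multi-indices that vanishes
  outside the finite index set of its shape, so that equality of functions is equality of tensors and
  the tensors of a shape are closed under the pointwise vector space operations.
\<close>

type_synonym tensor = "(nat \<Rightarrow> nat) \<Rightarrow> real"

definition indices :: "nat list \<Rightarrow> (nat \<Rightarrow> nat) set" where
  "indices d = (\<Pi>\<^sub>E k\<in>{..<length d}. {..<d ! k})"

definition tensors :: "nat list \<Rightarrow> tensor set" where
  "tensors d = {Z. \<forall>\<iota>. \<iota> \<notin> indices d \<longrightarrow> Z \<iota> = 0}"

definition tensor_inner :: "nat list \<Rightarrow> tensor \<Rightarrow> tensor \<Rightarrow> real" where
  "tensor_inner d Y Z = (\<Sum>\<iota>\<in>indices d. Y \<iota> * Z \<iota>)"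

definition frob_norm :: "nat list \<Rightarrow> tensor \<Rightarrow> real" where
  "frob_norm d Z = sqrt (tensor_inner d Z Z)"

definition tensor_tendsto :: "nat list \<Rightarrow> (nat \<Rightarrow> tensor) \<Rightarrow> tensor \<Rightarrow> bool" where
  "tensor_tendsto d Z L \<longleftrightarrow> (\<lambda>k. frob_norm d (\<lambda>\<iota>. Z k \<iota> - L \<iota>)) \<longlonglongrightarrow> 0"

definition unfold_pos :: "nat list \<Rightarrow> nat \<Rightarrow> (nat \<Rightarrow> nat) \<Rightarrow> nat \<times> nat" where
  "unfold_pos d i \<iota> =
     (\<iota> i, \<Sum>k\<in>{..<length d} - {i}. \<iota> k * (\<Prod>m\<in>{..<k} - {i}. d ! m))"

text \<open>
  \<open>unfold_pos d i\<close> is a bijection from the index set onto the positions of a matrix with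
  \<open>d ! i\<close> rows and \<open>\<Prod>k\<noteq>i. d ! k\<close> columns, so \<open>inv_into\<close> recovers the multi-index of a position.
\<close>

definition mode_unfold :: "nat list \<Rightarrow> nat \<Rightarrow> tensor \<Rightarrow> real mat" where
  "mode_unfold d i Z =
     mat (d ! i) (\<Prod>k\<in>{..<length d} - {i}. d ! k)
       (\<lambda>pos. Z (inv_into (indices d) (unfold_pos d i) pos))"

definition mode_refold :: "nat list \<Rightarrow> nat \<Rightarrow> real mat \<Rightarrow> tensor" where
  "mode_refold d i M = (\<lambda>\<iota>. if \<iota> \<in> indices d then M $$ unfold_pos d i \<iota> else 0)"

text \<open>
  The reduced decomposition: \<open>U\<close> and \<open>V\<close> have \<open>r = min m n\<close> orthonormal columns. The singular values
  are listed with multiplicity, in any order.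
\<close>

definition is_svd :: "real mat \<Rightarrow> real mat \<Rightarrow> real list \<Rightarrow> real mat \<Rightarrow> bool" where
  "is_svd X U s V \<longleftrightarrow>
     (let m = dim_row X; n = dim_col X; r = min m n in
        U \<in> carrier_mat m r \<and> V \<in> carrier_mat n r \<and> length s = r \<and>
        transpose_mat U * U = 1\<^sub>m r \<and> transpose_mat V * V = 1\<^sub>m r \<and>
        (\<forall>\<sigma>\<in>set s. 0 \<le> \<sigma>) \<and>
        X = U * mat_diag r (\<lambda>j. s ! j) * transpose_mat V)"

text \<open>
  A decomposition always exists. It is not unique, but neither the nuclear norm nor the singular
  value thresholding depends on the decomposition that is chosen.
\<close>

definition some_svd :: "real mat \<Rightarrow> real mat \<times> real list \<times> real mat" where
  "some_svd X = (SOME (U, s, V). is_svd X U s V)"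

definition nuclear_norm :: "real mat \<Rightarrow> real" where
  "nuclear_norm X = (case some_svd X of (U, s, V) \<Rightarrow> sum_list s)"

definition sv_threshold :: "real \<Rightarrow> real mat \<Rightarrow> real mat" where
  "sv_threshold \<tau> X =
     (case some_svd X of (U, s, V) \<Rightarrow>
        U * mat_diag (length s) (\<lambda>j. max (s ! j - \<tau>) 0) * transpose_mat V)"

definition tensor_linear :: "nat list \<Rightarrow> nat \<Rightarrow> (tensor \<Rightarrow> real vec) \<Rightarrow> bool" where
  "tensor_linear d p A \<longleftrightarrow>
     (\<forall>Z\<in>tensors d. A Z \<in> carrier_vec p) \<and>
     (\<forall>Y\<in>tensors d. \<forall>Z\<in>tensors d. A (\<lambda>\<iota>. Y \<iota> + Z \<iota>) = A Y + A Z) \<and>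
     (\<forall>c. \<forall>Z\<in>tensors d. A (\<lambda>\<iota>. c * Z \<iota>) = c \<cdot>\<^sub>v A Z)"

definition solution_set :: "nat list \<Rightarrow> (tensor \<Rightarrow> real vec) \<Rightarrow> real vec \<Rightarrow> tensor set" where
  "solution_set d A b = {X \<in> tensors d. A X = b}"

definition frob_proj :: "nat list \<Rightarrow> tensor set \<Rightarrow> tensor \<Rightarrow> tensor" where
  "frob_proj d B Z = arg_min_on (\<lambda>X. frob_norm d (\<lambda>\<iota>. Z \<iota> - X \<iota>)) B"

definition normal_cone :: "nat list \<Rightarrow> tensor set \<Rightarrow> tensor \<Rightarrow> tensor set" where
  "normal_cone d B X =
     (if X \<in> B
      then {Z \<in> tensors d. \<forall>X'\<in>B. tensor_inner d Z (\<lambda>\<iota>. X' \<iota> - X \<iota>) \<le> 0}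
      else {})"

definition subdifferential :: "nat list \<Rightarrow> (tensor \<Rightarrow> real) \<Rightarrow> tensor \<Rightarrow> tensor set" where
  "subdifferential d h Y =
     {G \<in> tensors d. \<forall>Z\<in>tensors d. h Z \<ge> h Y + tensor_inner d G (\<lambda>\<iota>. Z \<iota> - Y \<iota>)}"

text \<open>
  A family \<open>Y_1, ..., Y_N\<close> of tensors is a function on modes of which only the values at modes
  below \<open>length d\<close> matter.
\<close>

definition KKT ::
  "nat list \<Rightarrow> (tensor \<Rightarrow> real vec) \<Rightarrow> real vec \<Rightarrow>
     tensor \<Rightarrow> (nat \<Rightarrow> tensor) \<Rightarrow> (nat \<Rightarrow> tensor) \<Rightarrow> bool" where
  "KKT d A b X Y \<Lambda> \<longleftrightarrow>
     X \<in> solution_set d A b \<and>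
     (\<forall>i<length d. Y i \<in> tensors d \<and> \<Lambda> i \<in> tensors d) \<and>
     (\<lambda>\<iota>. \<Sum>i<length d. \<Lambda> i \<iota>) \<in> normal_cone d (solution_set d A b) X \<and>
     (\<forall>i<length d. (\<lambda>\<iota>. - \<Lambda> i \<iota>) \<in> subdifferential d (\<lambda>Z. nuclear_norm (mode_unfold d i Z)) (Y i)) \<and>
     (\<forall>i<length d. X = Y i)"

definition constraint_indicator :: "tensor set \<Rightarrow> tensor \<Rightarrow> ereal" where
  "constraint_indicator B X = (if X \<in> B then 0 else \<infinity>)"

definition nuclear_objective :: "nat list \<Rightarrow> (nat \<Rightarrow> tensor) \<Rightarrow> real" where
  "nuclear_objective d Y = (\<Sum>i<length d. nuclear_norm (mode_unfold d i (Y i)))"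

definition optimal_P ::
  "nat list \<Rightarrow> (tensor \<Rightarrow> real vec) \<Rightarrow> real vec \<Rightarrow> tensor \<Rightarrow> (nat \<Rightarrow> tensor) \<Rightarrow> bool" where
  "optimal_P d A b X Y \<longleftrightarrow>
     is_arg_min
       (\<lambda>(X, Y). constraint_indicator (solution_set d A b) X + ereal (nuclear_objective d Y))
       (\<lambda>(X, Y). X \<in> tensors d \<and> (\<forall>i<length d. Y i \<in> tensors d \<and> Y i = X))
       (X, Y)"

definition optimal_constrained ::
  "nat list \<Rightarrow> (tensor \<Rightarrow> real vec) \<Rightarrow> real vec \<Rightarrow> tensor \<Rightarrow> (nat \<Rightarrow> tensor) \<Rightarrow> bool" where
  "optimal_constrained d A b X Y \<longleftrightarrow>
     is_arg_min
       (\<lambda>(X, Y). nuclear_objective d Y)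
       (\<lambda>(X, Y). X \<in> solution_set d A b \<and> (\<forall>i<length d. Y i \<in> tensors d \<and> Y i = X))
       (X, Y)"

text \<open>
  \<open>Y k i\<close> and \<open>\<Lambda> k i\<close> are the \<open>k\<close>-th iterates for mode \<open>i\<close>. The algorithm does not use \<open>X 0\<close>,
  which is left arbitrary.
\<close>

definition SALM ::
  "nat list \<Rightarrow> (tensor \<Rightarrow> real vec) \<Rightarrow> real vec \<Rightarrow> (nat \<Rightarrow> real) \<Rightarrow>
     (nat \<Rightarrow> tensor) \<Rightarrow> (nat \<Rightarrow> nat \<Rightarrow> tensor) \<Rightarrow> (nat \<Rightarrow> nat \<Rightarrow> tensor) \<Rightarrow> bool" where
  "SALM d A b \<beta> X Y \<Lambda> \<longleftrightarrow>
     (\<forall>i<length d. Y 0 i \<in> tensors d \<and> \<Lambda> 0 i \<in> tensors d) \<and>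
     (\<forall>k. X (Suc k) =
        frob_proj d (solution_set d A b)
          (\<lambda>\<iota>. 1 / (real (length d) * \<beta> k) *
                 ((\<Sum>i<length d. \<Lambda> k i \<iota>) + (\<Sum>i<length d. \<beta> k * Y k i \<iota>)))) \<and>
     (\<forall>k. \<forall>i<length d. Y (Suc k) i =
        mode_refold d i
          (sv_threshold (1 / \<beta> k)
            (mode_unfold d i (X (Suc k)) - (1 / \<beta> k) \<cdot>\<^sub>m mode_unfold d i (\<Lambda> k i)))) \<and>
     (\<forall>k. \<forall>i<length d. \<Lambda> (Suc k) i =
        (\<lambda>\<iota>. \<Lambda> k i \<iota> - \<beta> k * (X (Suc k) \<iota> - Y (Suc k) i \<iota>)))"

end

theory Submission
  imports
    Defs
    "HOL-Analysis.Function_Topology"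
    "HOL-Analysis.Elementary_Metric_Spaces"
    "Jordan_Normal_Form.Determinant"
begin

text \<open>
  SALM is the two-block ADMM with an increasing penalty: by duality between the nuclear and the
  spectral norm, singular value thresholding is the proximal map of the nuclear norm, so
  \<open>-\<Lambda>_i^{k+1} \<in> \<partial>h_i(Y_i^{k+1})\<close>. For every KKT point \<open>(X*, \<Lambda>*)\<close> the energy
  \<open>\<Sum>i. \<bar>Y_i^k - X*\<bar>^2 + \<bar>\<Lambda>_i^k - \<Lambda>_i*\<bar>^2 / (\<beta>^k)^2\<close> decreases by at least the squared residuals plus
  \<open>2 / \<beta>^k\<close> times a nonnegative optimality gap. Since \<open>\<Sum>k. 1 / \<beta>^k\<close> diverges, the gap tends to zero
  along a subsequence, and by boundedness of the multipliers a further subsequence converges to some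
  \<open>(X\<infinity>, \<Lambda>\<infinity>)\<close>. If \<open>\<beta>\<close> is bounded, this pair is a KKT point. If \<open>\<beta>\<close> is unbounded, the vanishing gap
  makes \<open>(X\<infinity>, \<Lambda>*)\<close> a KKT point, and the multiplier part of the energy vanishes in the limit. In both
  cases the energy relative to the new KKT point tends to zero along the subsequence, hence altogether.
\<close>

section \<open>Tensors and subgradients\<close>

text \<open>The usual ADMM energy weights its primal part by \<beta> and its dual part by 1 /
  \<beta>, so its primal part may grow with \<beta>. Divided by \<beta>, it becomes a quantity that
  an increase of \<beta> can only lower; the price is the factor 2 / \<beta> in front of the gap,
  and this is where the divergent series comes in. The obstacle is the limit of the projection step:
  its normal vector contains \<beta> times the difference of consecutive \<open>Y\<close> iterates.
  The differences tend to zero, but for unbounded \<beta> the products need not, so the normal cone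
  condition does not pass to the limit multipliers in this way. The way out is to keep the given
  multipliers and to move only the primal point: a vanishing gap forces equality in the optimality
  inequalities, so these multipliers fit the new point as well. About \<open>h i\<close> the
  convergence argument uses only subadditivity and subdifferentiability; matrices enter
  afterwards.\<close>

lemma finite_indices: "finite (indices d)"
  unfolding indices_def by (intro finite_PiE) auto

lemma tensor_inner_commute: "tensor_inner d Y Z = tensor_inner d Z Y"
  by (simp add: tensor_inner_def mult.commute)

lemma tensor_inner_diff_right:
  "tensor_inner d G (\<lambda>\<iota>. Y \<iota> - Z \<iota>) = tensor_inner d G Y - tensor_inner d G Z"
  by (simp add: tensor_inner_def sum_subtractf algebra_simps)

lemma tensor_inner_diff_left:
  "tensor_inner d (\<lambda>\<iota>. Y \<iota> - Z \<iota>) G = tensor_inner d Y G - tensor_inner d Z G"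
  by (simp add: tensor_inner_def sum_subtractf algebra_simps)

lemma tensor_inner_minus_left: "tensor_inner d (\<lambda>\<iota>. - Y \<iota>) Z = - tensor_inner d Y Z"
  by (simp add: tensor_inner_def sum_negf)

lemma tensor_inner_sum_left:
  "tensor_inner d (\<lambda>\<iota>. \<Sum>i\<in>S. Y i \<iota>) Z = (\<Sum>i\<in>S. tensor_inner d (Y i) Z)"
  unfolding tensor_inner_def by (subst sum.swap) (simp add: sum_distrib_right)

lemma tensor_inner_tendsto:
  assumes "\<And>\<iota>. \<iota> \<in> indices d \<Longrightarrow> ((\<lambda>n. Y n \<iota>) \<longlongrightarrow> Y' \<iota>) F"
    and "\<And>\<iota>. \<iota> \<in> indices d \<Longrightarrow> ((\<lambda>n. Z n \<iota>) \<longlongrightarrow> Z' \<iota>) F"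
  shows "((\<lambda>n. tensor_inner d (Y n) (Z n)) \<longlongrightarrow> tensor_inner d Y' Z') F"
  unfolding tensor_inner_def using assms by (intro tendsto_sum tendsto_mult)

lemma tensors_closed_under:
  "Y \<in> tensors d \<Longrightarrow> Z \<in> tensors d \<Longrightarrow> (\<lambda>\<iota>. Y \<iota> + Z \<iota>) \<in> tensors d"
  "Y \<in> tensors d \<Longrightarrow> Z \<in> tensors d \<Longrightarrow> (\<lambda>\<iota>. Y \<iota> - Z \<iota>) \<in> tensors d"
  "Y \<in> tensors d \<Longrightarrow> (\<lambda>\<iota>. - Y \<iota>) \<in> tensors d"
  "Y \<in> tensors d \<Longrightarrow> (\<lambda>\<iota>. c * Y \<iota>) \<in> tensors d"
  "(\<And>i. i \<in> S \<Longrightarrow> W i \<in> tensors d) \<Longrightarrow> (\<lambda>\<iota>. \<Sum>i\<in>S. W i \<iota>) \<in> tensors d"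
  by (auto simp: tensors_def)

lemma tensor_tendsto_pointwise:
  assumes "\<And>\<iota>. \<iota> \<in> indices d \<Longrightarrow> (\<lambda>k. Z k \<iota>) \<longlonglongrightarrow> L \<iota>"
  shows "tensor_tendsto d Z L"
proof -
  have "(\<lambda>k. tensor_inner d (\<lambda>\<iota>. Z k \<iota> - L \<iota>) (\<lambda>\<iota>. Z k \<iota> - L \<iota>))
      \<longlonglongrightarrow> tensor_inner d (\<lambda>\<iota>. L \<iota> - L \<iota>) (\<lambda>\<iota>. L \<iota> - L \<iota>)"
    by (intro tensor_inner_tendsto tendsto_diff assms tendsto_const)
  then have "(\<lambda>k. tensor_inner d (\<lambda>\<iota>. Z k \<iota> - L \<iota>) (\<lambda>\<iota>. Z k \<iota> - L \<iota>)) \<longlonglongrightarrow> 0"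
    by (simp add: tensor_inner_def)
  then have "(\<lambda>k. sqrt (tensor_inner d (\<lambda>\<iota>. Z k \<iota> - L \<iota>) (\<lambda>\<iota>. Z k \<iota> - L \<iota>))) \<longlonglongrightarrow> sqrt 0"
    by (rule tendsto_real_sqrt)
  then show ?thesis by (simp add: tensor_tendsto_def frob_norm_def)
qed

text \<open>\<open>closed\<close> refers to the product topology on functions, in which convergence
  is exactly entrywise convergence.\<close>

lemma pointwise_limit_in_closed:
  fixes Z :: "nat \<Rightarrow> 'a \<Rightarrow> real"
  assumes "closed B" "\<And>n. Z n \<in> B" "\<And>\<iota>. (\<lambda>n. Z n \<iota>) \<longlonglongrightarrow> L \<iota>"
  shows "L \<in> B"
proof -
  have "limitin (product_topology (\<lambda>i. euclidean) UNIV) Z L sequentially"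
    using assms(3) by (simp add: limitin_componentwise)
  then have "Z \<longlonglongrightarrow> L" by (simp add: euclidean_product_topology)
  then show ?thesis
    using Lim_in_closed_set[of B Z sequentially L] assms by simp
qed

text \<open>Bolzano-Weierstrass in finitely many coordinates, on functions whose remaining
  coordinates are unconstrained.\<close>

lemma subsequence_pointwise_convergent:
  fixes f :: "nat \<Rightarrow> 'i \<Rightarrow> real"
  assumes "finite I" "\<And>n i. i \<in> I \<Longrightarrow> \<bar>f n i\<bar> \<le> C i"
  shows "\<exists>r l. strict_mono r \<and> (\<forall>i\<in>I. (\<lambda>n. f (r n) i) \<longlonglongrightarrow> l i)"
proof -
  have "\<exists>l r. strict_mono r \<and>
      (\<forall>\<epsilon>>0. eventually (\<lambda>n. \<forall>i\<in>I. dist (f (r n) i) (l i) < \<epsilon>) sequentially)"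
    \<comment> \<open>A function is its own coordinate family, so the identity serves both as the
      projection to coordinates and as its inverse.\<close>
    by (rule compact_lemma_general[of I "\<lambda>x. x" f "\<lambda>x. x", rule_format, OF _ _ _ _ subset_refl])
       (use assms in \<open>auto simp: bounded_iff\<close>)
  then obtain l r where r: "strict_mono r"
    and l: "\<And>\<epsilon>. \<epsilon> > 0 \<Longrightarrow> eventually (\<lambda>n. \<forall>i\<in>I. dist (f (r n) i) (l i) < \<epsilon>) sequentially"
    by blast
  have "(\<lambda>n. f (r n) i) \<longlonglongrightarrow> l i" if "i \<in> I" for i
    unfolding tendsto_iff using that by (auto intro: eventually_mono[OF l])
  then show ?thesis using r by blast
qed

section \<open>Monotonicity, boundedness and closedness of subdifferentials\<close>

lemma subdifferential_monotone:
  assumes "G \<in> subdifferential d h Y" "G' \<in> subdifferential d h Y'" "Y \<in> tensors d" "Y' \<in> tensors d"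
  shows "tensor_inner d (\<lambda>\<iota>. G \<iota> - G' \<iota>) (\<lambda>\<iota>. Y \<iota> - Y' \<iota>) \<ge> 0"
proof -
  have "h Y' \<ge> h Y + tensor_inner d G (\<lambda>\<iota>. Y' \<iota> - Y \<iota>)"
    "h Y \<ge> h Y' + tensor_inner d G' (\<lambda>\<iota>. Y \<iota> - Y' \<iota>)"
    using assms by (auto simp: subdifferential_def)
  then show ?thesis
    by (simp add: tensor_inner_diff_left tensor_inner_diff_right)
qed

text \<open>The subgradient inequality at \<open>Y\<close> plus c times a unit tensor gives, by
  subadditivity, a bound on c times the entry of \<open>G\<close> in which \<open>Y\<close> cancels.
  Taking c = 1 and c = -1 bounds the entry from both sides, uniformly in \<open>Y\<close>. This is
  the source of the bounded multipliers.\<close>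

lemma subgradient_bounded:
  assumes sub: "\<And>Y Z. Y \<in> tensors d \<Longrightarrow> Z \<in> tensors d \<Longrightarrow> h (\<lambda>\<iota>. Y \<iota> + Z \<iota>) \<le> h Y + h Z"
  shows "\<exists>C. \<forall>Y\<in>tensors d. \<forall>G\<in>subdifferential d h Y. \<forall>\<iota>\<in>indices d. \<bar>G \<iota>\<bar> \<le> (C \<iota> :: real)"
proof -
  define e :: "real \<Rightarrow> (nat \<Rightarrow> nat) \<Rightarrow> tensor" where "e c \<kappa> = (\<lambda>\<iota>. if \<iota> = \<kappa> then c else 0)" for c \<kappa>
  have "\<bar>G \<iota>\<bar> \<le> max (h (e 1 \<iota>)) (h (e (-1) \<iota>))"
    if Y: "Y \<in> tensors d" and G: "G \<in> subdifferential d h Y" and \<iota>: "\<iota> \<in> indices d" for Y G \<iota>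
  proof -
    have "c * G \<iota> \<le> h (e c \<iota>)" for c
    proof -
      have e: "e c \<iota> \<in> tensors d" using \<iota> by (auto simp: e_def tensors_def)
      have "\<forall>Z\<in>tensors d. h Z \<ge> h Y + tensor_inner d G (\<lambda>\<iota>. Z \<iota> - Y \<iota>)"
        using G by (simp add: subdifferential_def)
      from bspec[OF this tensors_closed_under(1)[OF Y e]]
      have "h (\<lambda>\<kappa>. Y \<kappa> + e c \<iota> \<kappa>) \<ge> h Y + tensor_inner d G (\<lambda>\<kappa>. Y \<kappa> + e c \<iota> \<kappa> - Y \<kappa>)"
        .
      moreover have "tensor_inner d G (\<lambda>\<kappa>. Y \<kappa> + e c \<iota> \<kappa> - Y \<kappa>) = c * G \<iota>"
      proof -
        have "(\<lambda>\<kappa>. Y \<kappa> + e c \<iota> \<kappa> - Y \<kappa>) = e c \<iota>" by auto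
        then show ?thesis
          using \<iota> finite_indices[of d] by (simp add: tensor_inner_def e_def if_distrib cong: if_cong)
      qed
      ultimately show ?thesis using sub[OF Y e] by simp
    qed
    from this[of 1] this[of "-1"] show ?thesis by simp
  qed
  then show ?thesis by (intro exI[of _ "\<lambda>\<iota>. max (h (e 1 \<iota>)) (h (e (-1) \<iota>))"]) blast
qed

text \<open>The graph of the subdifferential is closed once \<open>h\<close> is lower semicontinuous
  at the limit. Any subgradient \<open>H\<close> at \<open>Y'\<close> supplies this: its affine
  minorant bounds \<open>h (Y n)\<close> from below and tends to \<open>h Y'\<close>.\<close>

lemma subdifferential_closed:
  assumes sub: "\<And>n. G n \<in> subdifferential d h (Y n)"
    and Y: "\<And>n. Y n \<in> tensors d" "Y' \<in> tensors d" and G': "G' \<in> tensors d"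
    and ne: "subdifferential d h Y' \<noteq> {}"
    and lim: "\<And>\<iota>. \<iota> \<in> indices d \<Longrightarrow> (\<lambda>n. G n \<iota>) \<longlonglongrightarrow> G' \<iota>"
      "\<And>\<iota>. \<iota> \<in> indices d \<Longrightarrow> (\<lambda>n. Y n \<iota>) \<longlonglongrightarrow> Y' \<iota>"
  shows "G' \<in> subdifferential d h Y'"
proof -
  obtain H where H: "H \<in> subdifferential d h Y'" using ne by blast
  have "h Z \<ge> h Y' + tensor_inner d G' (\<lambda>\<iota>. Z \<iota> - Y' \<iota>)" if Z: "Z \<in> tensors d" for Z
  proof (rule LIMSEQ_le_const2)
    have "(\<lambda>n. h Y' + tensor_inner d H (\<lambda>\<iota>. Y n \<iota> - Y' \<iota>) + tensor_inner d (G n) (\<lambda>\<iota>. Z \<iota> - Y n \<iota>))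
        \<longlonglongrightarrow> h Y' + tensor_inner d H (\<lambda>\<iota>. Y' \<iota> - Y' \<iota>) + tensor_inner d G' (\<lambda>\<iota>. Z \<iota> - Y' \<iota>)"
      by (intro tendsto_intros tensor_inner_tendsto lim)
    then show "(\<lambda>n. h Y' + tensor_inner d H (\<lambda>\<iota>. Y n \<iota> - Y' \<iota>) + tensor_inner d (G n) (\<lambda>\<iota>. Z \<iota> - Y n \<iota>))
        \<longlonglongrightarrow> h Y' + tensor_inner d G' (\<lambda>\<iota>. Z \<iota> - Y' \<iota>)"
      by (simp add: tensor_inner_def)
    have "h Y' + tensor_inner d H (\<lambda>\<iota>. Y n \<iota> - Y' \<iota>) \<le> h (Y n)" for n
      using H Y by (auto simp: subdifferential_def)
    moreover have "h (Y n) + tensor_inner d (G n) (\<lambda>\<iota>. Z \<iota> - Y n \<iota>) \<le> h Z" for n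
      using sub Z by (auto simp: subdifferential_def)
    ultimately show "\<exists>N. \<forall>n\<ge>N. h Y' + tensor_inner d H (\<lambda>\<iota>. Y n \<iota> - Y' \<iota>) + tensor_inner d (G n) (\<lambda>\<iota>. Z \<iota> - Y n \<iota>) \<le> h Z"
      by (intro exI[of _ 0] allI impI) (smt (verit))
  qed
  then show ?thesis using G' by (auto simp: subdifferential_def)
qed

text \<open>The optimality system with the copies \<open>Y i\<close> eliminated, as they all equal
  \<open>X\<close>, and with a general set and general functions in place of the solution set and
  the nuclear norms.\<close>

definition kkt_point ::
  "nat list \<Rightarrow> tensor set \<Rightarrow> (nat \<Rightarrow> tensor \<Rightarrow> real) \<Rightarrow> tensor \<Rightarrow> (nat \<Rightarrow> tensor) \<Rightarrow> bool" where
  "kkt_point d B h X \<Lambda> \<longleftrightarrow>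
     X \<in> B \<and>
     (\<lambda>\<iota>. \<Sum>i<length d. \<Lambda> i \<iota>) \<in> normal_cone d B X \<and>
     (\<forall>i<length d. (\<lambda>\<iota>. - \<Lambda> i \<iota>) \<in> subdifferential d (h i) X)"

section \<open>Convergence of the ADMM with increasing penalty\<close>

text \<open>The two subproblems enter only through their optimality conditions.
  \<open>X_step\<close> is the variational inequality of the projection, scaled by the number of
  modes times \<beta>. \<open>Y_step\<close> has the new multiplier because the multiplier update
  turns the optimality condition of the proximal step into exactly this inclusion.\<close>

locale admm =
  fixes d :: "nat list" and B :: "tensor set" and h :: "nat \<Rightarrow> tensor \<Rightarrow> real"
    and \<beta> :: "nat \<Rightarrow> real" and X :: "nat \<Rightarrow> tensor" and Y \<Lambda> :: "nat \<Rightarrow> nat \<Rightarrow> tensor"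
  assumes closed_B: "closed B" and B_tensors: "B \<subseteq> tensors d"
    and subadditive: "\<And>i Y Z. i < length d \<Longrightarrow> Y \<in> tensors d \<Longrightarrow> Z \<in> tensors d \<Longrightarrow>
      h i (\<lambda>\<iota>. Y \<iota> + Z \<iota>) \<le> h i Y + h i Z"
    and subdifferentiable: "\<And>i Y. i < length d \<Longrightarrow> Y \<in> tensors d \<Longrightarrow> subdifferential d (h i) Y \<noteq> {}"
    and beta_pos: "\<And>k. \<beta> k > 0" and beta_incseq: "incseq \<beta>"
    and beta_divergent: "filterlim (\<lambda>K. \<Sum>k<K. 1 / \<beta> k) at_top sequentially"
    and Y_tensor: "\<And>k i. i < length d \<Longrightarrow> Y k i \<in> tensors d"
    and X_step: "\<And>k. (\<lambda>\<iota>. \<Sum>i<length d. \<Lambda> k i \<iota> + \<beta> k * (Y k i \<iota> - X (Suc k) \<iota>))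
      \<in> normal_cone d B (X (Suc k))"
    and Y_step: "\<And>k i. i < length d \<Longrightarrow>
      (\<lambda>\<iota>. - \<Lambda> (Suc k) i \<iota>) \<in> subdifferential d (h i) (Y (Suc k) i)"
    and multiplier_step: "\<And>k i \<iota>. i < length d \<Longrightarrow>
      \<Lambda> (Suc k) i \<iota> = \<Lambda> k i \<iota> - \<beta> k * (X (Suc k) \<iota> - Y (Suc k) i \<iota>)"
begin

lemma X_in_B: "X (Suc k) \<in> B"
  using X_step[of k] by (auto simp: normal_cone_def split: if_splits)

text \<open>The standard ADMM Lyapunov function divided by the penalty, so that \<beta> occurs only
  in a denominator.\<close>

definition energy :: "tensor \<Rightarrow> (nat \<Rightarrow> tensor) \<Rightarrow> nat \<Rightarrow> real" where
  "energy Xs Ls k = (\<Sum>i<length d. \<Sum>\<iota>\<in>indices d.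
     (Y k i \<iota> - Xs \<iota>)\<^sup>2 + (\<Lambda> k i \<iota> - Ls i \<iota>)\<^sup>2 / (\<beta> k)\<^sup>2)"

definition step_size :: "nat \<Rightarrow> real" where
  "step_size k = (\<Sum>i<length d. \<Sum>\<iota>\<in>indices d.
     (Y k i \<iota> - Y (Suc k) i \<iota>)\<^sup>2 + (X (Suc k) \<iota> - Y (Suc k) i \<iota>)\<^sup>2)"

text \<open>\<open>gap_Y\<close> is the monotonicity product of the subdifferentials at the new
  \<open>Y\<close> and at \<open>Xs\<close>. The monotonicity product of the normal cones at the new
  \<open>X\<close> and at \<open>Xs\<close> is split into \<open>gap_step\<close> and
  \<open>gap_X\<close>: each is nonnegative by itself, and \<open>gap_X\<close> carries only the
  fixed multipliers, so its limit involves no \<beta>.\<close>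

definition gap_Y :: "tensor \<Rightarrow> (nat \<Rightarrow> tensor) \<Rightarrow> nat \<Rightarrow> real" where
  "gap_Y Xs Ls k = (\<Sum>i<length d.
     tensor_inner d (\<lambda>\<iota>. Ls i \<iota> - \<Lambda> (Suc k) i \<iota>) (\<lambda>\<iota>. Y (Suc k) i \<iota> - Xs \<iota>))"

definition gap_step :: "tensor \<Rightarrow> nat \<Rightarrow> real" where
  "gap_step Xs k = tensor_inner d (\<lambda>\<iota>. \<Sum>i<length d. \<Lambda> k i \<iota> + \<beta> k * (Y k i \<iota> - X (Suc k) \<iota>))
     (\<lambda>\<iota>. X (Suc k) \<iota> - Xs \<iota>)"

definition gap_X :: "tensor \<Rightarrow> (nat \<Rightarrow> tensor) \<Rightarrow> nat \<Rightarrow> real" where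
  "gap_X Xs Ls k = tensor_inner d (\<lambda>\<iota>. \<Sum>i<length d. Ls i \<iota>) (\<lambda>\<iota>. Xs \<iota> - X (Suc k) \<iota>)"

lemma gap_nonneg:
  assumes "kkt_point d B h Xs Ls"
  shows "gap_Y Xs Ls k \<ge> 0" "gap_step Xs k \<ge> 0" "gap_X Xs Ls k \<ge> 0"
proof -
  have Xs: "Xs \<in> B" "Xs \<in> tensors d" using assms B_tensors by (auto simp: kkt_point_def)
  have "tensor_inner d (\<lambda>\<iota>. Ls i \<iota> - \<Lambda> (Suc k) i \<iota>) (\<lambda>\<iota>. Y (Suc k) i \<iota> - Xs \<iota>) \<ge> 0"
    if "i < length d" for i
    using subdifferential_monotone[OF Y_step[OF that, of k], of "\<lambda>\<iota>. - Ls i \<iota>" Xs] assms that Xs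
      Y_tensor[OF that]
    by (simp add: kkt_point_def)
  then show "gap_Y Xs Ls k \<ge> 0" unfolding gap_Y_def by (intro sum_nonneg) auto
  have "tensor_inner d (\<lambda>\<iota>. \<Sum>i<length d. \<Lambda> k i \<iota> + \<beta> k * (Y k i \<iota> - X (Suc k) \<iota>))
     (\<lambda>\<iota>. Xs \<iota> - X (Suc k) \<iota>) \<le> 0"
    using X_step[of k] Xs X_in_B[of k] by (auto simp: normal_cone_def)
  then show "gap_step Xs k \<ge> 0" unfolding gap_step_def by (simp add: tensor_inner_diff_right)
  have "tensor_inner d (\<lambda>\<iota>. \<Sum>i<length d. Ls i \<iota>) (\<lambda>\<iota>. X (Suc k) \<iota> - Xs \<iota>) \<le> 0"
    using assms Xs X_in_B[of k] by (auto simp: normal_cone_def kkt_point_def)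
  then show "gap_X Xs Ls k \<ge> 0" unfolding gap_X_def by (simp add: tensor_inner_diff_right)
qed

text \<open>An entrywise identity combined with two inequalities: the sign of the cross term
  \<open>M\<close> and the monotonicity of \<beta>. The restriction on \<open>k\<close> comes from
  \<open>M\<close>, which compares subgradients at two consecutive iterates, while the initial
  multipliers are unrelated to the subdifferential at the initial \<open>Y\<close>.\<close>

lemma energy_decrease:
  assumes kkt: "kkt_point d B h Xs Ls" and k: "k \<ge> 1"
  shows "energy Xs Ls (Suc k) + step_size k
      + 2 / \<beta> k * (gap_Y Xs Ls k + gap_step Xs k + gap_X Xs Ls k) \<le> energy Xs Ls k"
proof -
  let ?S = "\<lambda>f. \<Sum>i<length d. \<Sum>\<iota>\<in>indices d. f i \<iota>"
  let ?b = "\<beta> k" let ?X' = "X (Suc k)" let ?Y = "Y k" let ?Y' = "Y (Suc k)"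
  let ?L = "\<Lambda> k" let ?L' = "\<Lambda> (Suc k)"
  define M where "M = ?S (\<lambda>i \<iota>. (?Y i \<iota> - ?Y' i \<iota>) * (?L i \<iota> - ?L' i \<iota>))"
  \<comment> \<open>Monotonicity of each subdifferential between the steps k and k + 1; the sign
    flips because the subgradients are the negated multipliers.\<close>
  have "M \<le> 0"
  proof -
    have "tensor_inner d (\<lambda>\<iota>. ?Y i \<iota> - ?Y' i \<iota>) (\<lambda>\<iota>. ?L i \<iota> - ?L' i \<iota>) \<le> 0" if i: "i < length d" for i
    proof -
      obtain j where j: "k = Suc j" using k by (cases k) auto
      have "tensor_inner d (\<lambda>\<iota>. - ?L i \<iota> - - ?L' i \<iota>) (\<lambda>\<iota>. ?Y i \<iota> - ?Y' i \<iota>) \<ge> 0"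
        using subdifferential_monotone[OF Y_step[OF i, of j] Y_step[OF i, of k]] Y_tensor[OF i] j
        by simp
      then show ?thesis
        by (simp add: tensor_inner_diff_left tensor_inner_diff_right tensor_inner_minus_left
            tensor_inner_commute)
    qed
    then show ?thesis unfolding M_def tensor_inner_def by (meson lessThan_iff sum_nonpos)
  qed
  have gY: "gap_Y Xs Ls k = ?S (\<lambda>i \<iota>. (Ls i \<iota> - ?L' i \<iota>) * (?Y' i \<iota> - Xs \<iota>))"
    by (simp add: gap_Y_def tensor_inner_def)
  have gs: "gap_step Xs k = ?S (\<lambda>i \<iota>. (?L i \<iota> + ?b * (?Y i \<iota> - ?X' \<iota>)) * (?X' \<iota> - Xs \<iota>))"
    unfolding gap_step_def tensor_inner_sum_left by (simp add: tensor_inner_def)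
  have gX: "gap_X Xs Ls k = ?S (\<lambda>i \<iota>. Ls i \<iota> * (Xs \<iota> - ?X' \<iota>))"
    unfolding gap_X_def tensor_inner_sum_left by (simp add: tensor_inner_def)
  have b: "?b > 0" by (rule beta_pos)
  \<comment> \<open>After the old multiplier is expressed by the new one, both sides are the same
    polynomial in the entries and 1 / \<beta>.\<close>
  have point: "(?Y' i \<iota> - Xs \<iota>)\<^sup>2 + (?L' i \<iota> - Ls i \<iota>)\<^sup>2 / ?b\<^sup>2
      + ((?Y i \<iota> - ?Y' i \<iota>)\<^sup>2 + (?X' \<iota> - ?Y' i \<iota>)\<^sup>2)
      + 2 / ?b * ((Ls i \<iota> - ?L' i \<iota>) * (?Y' i \<iota> - Xs \<iota>)
        + (?L i \<iota> + ?b * (?Y i \<iota> - ?X' \<iota>)) * (?X' \<iota> - Xs \<iota>) + Ls i \<iota> * (Xs \<iota> - ?X' \<iota>))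
      = (?Y i \<iota> - Xs \<iota>)\<^sup>2 + (?L i \<iota> - Ls i \<iota>)\<^sup>2 / ?b\<^sup>2
      + 2 / ?b * ((?Y i \<iota> - ?Y' i \<iota>) * (?L i \<iota> - ?L' i \<iota>))" if "i < length d" for i \<iota>
  proof -
    have L': "?L i \<iota> = ?L' i \<iota> + ?b * (?X' \<iota> - ?Y' i \<iota>)" using multiplier_step[OF that] by simp
    show ?thesis unfolding L' using b by (simp add: field_simps power2_eq_square)
  qed
  \<comment> \<open>The only place where the growth of \<beta> matters: the dual part at step k + 1
    has the larger denominator.\<close>
  have b': "(1 / \<beta> (Suc k))\<^sup>2 \<le> (1 / ?b)\<^sup>2"
    using b incseqD[OF beta_incseq, of k "Suc k"] by (intro power_mono divide_left_mono) auto
  have "energy Xs Ls (Suc k) \<le> ?S (\<lambda>i \<iota>. (?Y' i \<iota> - Xs \<iota>)\<^sup>2 + (?L' i \<iota> - Ls i \<iota>)\<^sup>2 / ?b\<^sup>2)"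
    unfolding energy_def
  proof (intro sum_mono add_left_mono)
    fix i \<iota>
    show "(?L' i \<iota> - Ls i \<iota>)\<^sup>2 / (\<beta> (Suc k))\<^sup>2 \<le> (?L' i \<iota> - Ls i \<iota>)\<^sup>2 / ?b\<^sup>2"
      using mult_left_mono[OF b', of "(?L' i \<iota> - Ls i \<iota>)\<^sup>2"] by (simp add: power_divide)
  qed
  then have "energy Xs Ls (Suc k) + step_size k
      + 2 / ?b * (gap_Y Xs Ls k + gap_step Xs k + gap_X Xs Ls k)
    \<le> ?S (\<lambda>i \<iota>. (?Y' i \<iota> - Xs \<iota>)\<^sup>2 + (?L' i \<iota> - Ls i \<iota>)\<^sup>2 / ?b\<^sup>2)
      + step_size k + 2 / ?b * (gap_Y Xs Ls k + gap_step Xs k + gap_X Xs Ls k)"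
    by simp
  also have "\<dots>
     = ?S (\<lambda>i \<iota>. (?Y' i \<iota> - Xs \<iota>)\<^sup>2 + (?L' i \<iota> - Ls i \<iota>)\<^sup>2 / ?b\<^sup>2
      + ((?Y i \<iota> - ?Y' i \<iota>)\<^sup>2 + (?X' \<iota> - ?Y' i \<iota>)\<^sup>2)
      + 2 / ?b * ((Ls i \<iota> - ?L' i \<iota>) * (?Y' i \<iota> - Xs \<iota>)
        + (?L i \<iota> + ?b * (?Y i \<iota> - ?X' \<iota>)) * (?X' \<iota> - Xs \<iota>) + Ls i \<iota> * (Xs \<iota> - ?X' \<iota>)))"
    unfolding gY gs gX step_size_def
    by (simp only: sum.distrib sum_distrib_left distrib_left)
  also have "\<dots> = ?S (\<lambda>i \<iota>. (?Y i \<iota> - Xs \<iota>)\<^sup>2 + (?L i \<iota> - Ls i \<iota>)\<^sup>2 / ?b\<^sup>2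
      + 2 / ?b * ((?Y i \<iota> - ?Y' i \<iota>) * (?L i \<iota> - ?L' i \<iota>)))"
    by (intro sum.cong refl point) auto
  also have "\<dots> = energy Xs Ls k + 2 / ?b * M"
    unfolding energy_def M_def by (simp only: sum.distrib sum_distrib_left)
  also have "\<dots> \<le> energy Xs Ls k"
    using \<open>M \<le> 0\<close> b by (simp add: divide_nonpos_pos)
  finally show ?thesis by simp
qed

end

section \<open>Limits extracted from the energy decrease\<close>

lemma le_double_sum:
  fixes f :: "nat \<Rightarrow> 'a \<Rightarrow> real"
  assumes "i < n" "j \<in> J" "finite J" "\<And>i j. f i j \<ge> 0"
  shows "f i j \<le> (\<Sum>i<n. \<Sum>j\<in>J. f i j)"
proof -
  have "f i j \<le> (\<Sum>j\<in>J. f i j)" using assms by (intro member_le_sum) auto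
  also have "\<dots> \<le> (\<Sum>i<n. \<Sum>j\<in>J. f i j)"
    using assms by (intro member_le_sum[of i "{..<n}" "\<lambda>i. \<Sum>j\<in>J. f i j"]) (auto intro: sum_nonneg)
  finally show ?thesis .
qed

lemma null_if_square_le_null:
  fixes f g :: "nat \<Rightarrow> real"
  assumes "\<And>n. (f n)\<^sup>2 \<le> g n" "g \<longlonglongrightarrow> 0"
  shows "f \<longlonglongrightarrow> 0"
proof -
  have "(\<lambda>n. (f n)\<^sup>2) \<longlonglongrightarrow> 0"
    by (rule tendsto_sandwich[OF _ _ tendsto_const assms(2)]) (use assms(1) in auto)
  then show ?thesis by simp
qed

context admm begin

lemma energy_nonneg: "energy Xs Ls k \<ge> 0"
  unfolding energy_def by (intro sum_nonneg) auto

lemma step_size_nonneg: "step_size k \<ge> 0"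
  unfolding step_size_def by (intro sum_nonneg) auto

lemma Y_dist_le_energy:
  assumes "i < length d" "\<iota> \<in> indices d"
  shows "(Y k i \<iota> - Xs \<iota>)\<^sup>2 \<le> energy Xs Ls k"
proof -
  have "(Y k i \<iota> - Xs \<iota>)\<^sup>2 \<le> (Y k i \<iota> - Xs \<iota>)\<^sup>2 + (\<Lambda> k i \<iota> - Ls i \<iota>)\<^sup>2 / (\<beta> k)\<^sup>2" by simp
  also have "\<dots> \<le> energy Xs Ls k"
    unfolding energy_def
    by (rule le_double_sum[where f = "\<lambda>i \<iota>. (Y k i \<iota> - Xs \<iota>)\<^sup>2 + (\<Lambda> k i \<iota> - Ls i \<iota>)\<^sup>2 / (\<beta> k)\<^sup>2"])
       (use assms finite_indices in auto)
  finally show ?thesis .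
qed

lemma residuals_le_step_size:
  assumes "i < length d" "\<iota> \<in> indices d"
  shows "(Y k i \<iota> - Y (Suc k) i \<iota>)\<^sup>2 \<le> step_size k"
    "(X (Suc k) \<iota> - Y (Suc k) i \<iota>)\<^sup>2 \<le> step_size k"
proof -
  have "(Y k i \<iota> - Y (Suc k) i \<iota>)\<^sup>2 + (X (Suc k) \<iota> - Y (Suc k) i \<iota>)\<^sup>2 \<le> step_size k"
    unfolding step_size_def
    by (rule le_double_sum[where f = "\<lambda>i \<iota>. (Y k i \<iota> - Y (Suc k) i \<iota>)\<^sup>2 + (X (Suc k) \<iota> - Y (Suc k) i \<iota>)\<^sup>2"])
       (use assms finite_indices in auto)
  then show "(Y k i \<iota> - Y (Suc k) i \<iota>)\<^sup>2 \<le> step_size k"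
    "(X (Suc k) \<iota> - Y (Suc k) i \<iota>)\<^sup>2 \<le> step_size k"
    using zero_le_power2[of "Y k i \<iota> - Y (Suc k) i \<iota>"]
      zero_le_power2[of "X (Suc k) \<iota> - Y (Suc k) i \<iota>"] by linarith+
qed

text \<open>The bound starts at \<open>Suc k\<close>, since only updated multipliers are negated
  subgradients.\<close>

lemma multiplier_bounded:
  assumes "i < length d"
  shows "\<exists>C. \<forall>k. \<forall>\<iota>\<in>indices d. \<bar>\<Lambda> (Suc k) i \<iota>\<bar> \<le> C \<iota>"
proof -
  from subgradient_bounded[of d "h i", OF subadditive[OF assms]]
  obtain C where C: "\<forall>Y\<in>tensors d. \<forall>G\<in>subdifferential d (h i) Y. \<forall>\<iota>\<in>indices d. \<bar>G \<iota>\<bar> \<le> (C \<iota> :: real)"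
    by blast
  have "\<bar>- \<Lambda> (Suc k) i \<iota>\<bar> \<le> C \<iota>" if "\<iota> \<in> indices d" for k \<iota>
    by (rule C[rule_format, OF Y_tensor[OF assms] Y_step[OF assms] that])
  then show ?thesis by (intro exI[of _ C]) simp
qed

definition gap :: "tensor \<Rightarrow> (nat \<Rightarrow> tensor) \<Rightarrow> nat \<Rightarrow> real" where
  "gap Xs Ls k = gap_Y Xs Ls k + gap_step Xs k + gap_X Xs Ls k"

context
  fixes Xs :: tensor and Ls :: "nat \<Rightarrow> tensor"
  assumes kkt: "kkt_point d B h Xs Ls"
begin

lemma energy_decrease':
  "k \<ge> 1 \<Longrightarrow> energy Xs Ls (Suc k) + step_size k + 2 / \<beta> k * gap Xs Ls k \<le> energy Xs Ls k"
  using energy_decrease[OF kkt] by (simp add: gap_def)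

lemma energy_decseq: "decseq (\<lambda>n. energy Xs Ls (Suc n))"
proof (rule decseq_SucI)
  fix n
  have "2 / \<beta> (Suc n) * gap Xs Ls (Suc n) \<ge> 0"
    using gap_nonneg[OF kkt, of "Suc n"] beta_pos[of "Suc n"] by (simp add: gap_def)
  then show "energy Xs Ls (Suc (Suc n)) \<le> energy Xs Ls (Suc n)"
    using energy_decrease'[of "Suc n"] step_size_nonneg[of "Suc n"] by linarith
qed

lemma energy_convergent: obtains c where "energy Xs Ls \<longlonglongrightarrow> c"
proof -
  obtain c where "(\<lambda>n. energy Xs Ls (Suc n)) \<longlonglongrightarrow> c"
    by (rule decseq_convergent[OF energy_decseq, of 0]) (simp add: energy_nonneg)
  then show ?thesis by (intro that[of c]) (simp add: filterlim_sequentially_Suc)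
qed

text \<open>The step sizes lie below the consecutive differences of the convergent energy.\<close>

lemma step_size_null: "step_size \<longlonglongrightarrow> 0"
proof -
  obtain c where c: "energy Xs Ls \<longlonglongrightarrow> c" by (rule energy_convergent)
  have "(\<lambda>k. energy Xs Ls k - energy Xs Ls (Suc k)) \<longlonglongrightarrow> c - c"
    by (intro tendsto_diff c LIMSEQ_Suc)
  then have lim: "(\<lambda>k. energy Xs Ls k - energy Xs Ls (Suc k)) \<longlonglongrightarrow> 0" by simp
  show ?thesis
  proof (rule tendsto_sandwich[OF _ _ tendsto_const lim])
    show "eventually (\<lambda>k. step_size k \<le> energy Xs Ls k - energy Xs Ls (Suc k)) sequentially"
      using eventually_ge_at_top[of 1]
    proof eventually_elim
      case (elim k)
      have "2 / \<beta> k * gap Xs Ls k \<ge> 0"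
        using gap_nonneg[OF kkt, of k] beta_pos[of k] by (simp add: gap_def)
      then show ?case using energy_decrease'[OF elim] by linarith
    qed
  qed (simp add: step_size_nonneg)
qed

text \<open>Summing the energy decrease bounds \<open>\<Sum>k. gap k / \<beta> k\<close>; as \<open>\<Sum>k. 1 / \<beta> k\<close> diverges,
  the gap cannot stay away from zero.\<close>

lemma gap_frequently_small:
  assumes "\<epsilon> > 0"
  shows "\<exists>k\<ge>n. gap Xs Ls k < \<epsilon>"
proof (rule ccontr)
  assume "\<not> ?thesis"
  then have ge: "gap Xs Ls k \<ge> \<epsilon>" if "k \<ge> n" for k using that by force
  \<comment> \<open>\<open>Suc n\<close> rather than \<open>n\<close> keeps every summation index at
    least 1, as \<open>energy_decrease'\<close> demands.\<close>
  define m where "m = Suc n"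
  have "energy Xs Ls K + 2 * \<epsilon> * ((\<Sum>k<K. 1 / \<beta> k) - (\<Sum>k<m. 1 / \<beta> k)) \<le> energy Xs Ls m"
    if "K \<ge> m" for K
    using that
  proof (induction K rule: dec_induct)
    case (step K)
    have "2 / \<beta> K * \<epsilon> \<le> 2 / \<beta> K * gap Xs Ls K"
      using ge[of K] step.hyps beta_pos[of K] by (intro mult_left_mono) (auto simp: m_def)
    moreover have "2 * \<epsilon> * ((\<Sum>k<Suc K. 1 / \<beta> k) - (\<Sum>k<m. 1 / \<beta> k))
      = 2 * \<epsilon> * ((\<Sum>k<K. 1 / \<beta> k) - (\<Sum>k<m. 1 / \<beta> k)) + 2 / \<beta> K * \<epsilon>"
      by (simp add: algebra_simps)
    ultimately show ?case
      using step.IH energy_decrease'[of K] step.hyps step_size_nonneg[of K]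
      by (simp only: m_def) linarith
  qed simp
  note sum_bound = this
  have le: "(\<Sum>k<K. 1 / \<beta> k) \<le> energy Xs Ls m / (2 * \<epsilon>) + (\<Sum>k<m. 1 / \<beta> k)" if "K \<ge> m" for K
    using sum_bound[OF that] energy_nonneg[of Xs Ls K] assms
    by (simp add: field_simps)
  have "eventually (\<lambda>K. (\<Sum>k<K. 1 / \<beta> k) > energy Xs Ls m / (2 * \<epsilon>) + (\<Sum>k<m. 1 / \<beta> k)) sequentially"
    using beta_divergent by (simp add: filterlim_at_top_dense)
  then obtain K where "K \<ge> m" "(\<Sum>k<K. 1 / \<beta> k) > energy Xs Ls m / (2 * \<epsilon>) + (\<Sum>k<m. 1 / \<beta> k)"
    using eventually_happens'[OF _ eventually_conj[OF eventually_ge_at_top[of m]]] by fastforce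
  with le[of K] show False by simp
qed

text \<open>The energy converges along the whole sequence, so a subsequence identifies its limit as
  zero. It controls only the \<open>Y\<close> iterates; \<open>X\<close> follows because the
  residual against one of them vanishes.\<close>

lemma converges_if_energy_null_subsequence:
  assumes "filterlim r at_top sequentially" "(\<lambda>n. energy Xs Ls (r n)) \<longlonglongrightarrow> 0"
    and "d \<noteq> []" "\<iota> \<in> indices d"
  shows "(\<lambda>k. X k \<iota>) \<longlonglongrightarrow> Xs \<iota>" "i < length d \<Longrightarrow> (\<lambda>k. Y k i \<iota>) \<longlonglongrightarrow> Xs \<iota>"
proof -
  obtain c where c: "energy Xs Ls \<longlonglongrightarrow> c" by (rule energy_convergent)
  from filterlim_compose[OF c assms(1)] have "c = 0" using LIMSEQ_unique[OF _ assms(2)] by simp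
  have Y: "(\<lambda>k. Y k i \<iota>) \<longlonglongrightarrow> Xs \<iota>" if "i < length d" for i
  proof -
    have "(\<lambda>k. Y k i \<iota> - Xs \<iota>) \<longlonglongrightarrow> 0"
      by (rule null_if_square_le_null[OF Y_dist_le_energy[OF that assms(4)]]) (use c \<open>c = 0\<close> in simp)
    then show ?thesis by (simp add: LIM_zero_iff)
  qed
  show "(\<lambda>k. Y k i \<iota>) \<longlonglongrightarrow> Xs \<iota>" if "i < length d" by (rule Y[OF that])
  \<comment> \<open>Mode 0 is the copy against which \<open>X\<close> is compared.\<close>
  have 0: "0 < length d" using assms(3) by simp
  have "(\<lambda>k. X (Suc k) \<iota> - Y (Suc k) 0 \<iota>) \<longlonglongrightarrow> 0"
    by (rule null_if_square_le_null[OF residuals_le_step_size(2)[OF 0 assms(4)] step_size_null])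
  from tendsto_add[OF this LIMSEQ_Suc[OF Y[OF 0]]]
  have "(\<lambda>k. X (Suc k) \<iota>) \<longlonglongrightarrow> Xs \<iota>" by simp
  then show "(\<lambda>k. X k \<iota>) \<longlonglongrightarrow> Xs \<iota>" by (rule filterlim_sequentially_Suc[THEN iffD1])
qed

text \<open>The iterates are taken at \<open>Suc (r n)\<close> because the gap at step k is built
  from the iterates at k + 1. The index map only has to tend to infinity, which spares making the
  chosen indices strictly increasing.\<close>

lemma gap_null_subsequence:
  "\<exists>r. filterlim r at_top sequentially \<and> (\<lambda>n. gap Xs Ls (r n)) \<longlonglongrightarrow> 0 \<and>
    (\<forall>i<length d. \<forall>\<iota>\<in>indices d.
      convergent (\<lambda>n. Y (Suc (r n)) i \<iota>) \<and> convergent (\<lambda>n. \<Lambda> (Suc (r n)) i \<iota>))"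
proof -
  obtain q where q: "\<And>n. q n \<ge> n" "\<And>n. gap Xs Ls (q n) < inverse (real (Suc n))"
  proof -
    have "\<forall>n. \<exists>k. n \<le> k \<and> gap Xs Ls k < inverse (real (Suc n))"
      using gap_frequently_small by simp
    from choice[OF this] that show thesis by blast
  qed
  have q_top: "filterlim q at_top sequentially"
    by (rule filterlim_at_top_mono[OF filterlim_ident]) (use q in auto)
  have gap_q: "(\<lambda>n. gap Xs Ls (q n)) \<longlonglongrightarrow> 0"
    by (rule tendsto_sandwich[OF _ _ tendsto_const LIMSEQ_inverse_real_of_nat])
       (use q gap_nonneg[OF kkt] in \<open>auto simp: gap_def less_imp_le\<close>)
  obtain C where C: "\<And>i k \<iota>. i < length d \<Longrightarrow> \<iota> \<in> indices d \<Longrightarrow> \<bar>\<Lambda> (Suc k) i \<iota>\<bar> \<le> C i \<iota>"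
  proof -
    have "\<forall>i. \<exists>C. i < length d \<longrightarrow> (\<forall>k. \<forall>\<iota>\<in>indices d. \<bar>\<Lambda> (Suc k) i \<iota>\<bar> \<le> C \<iota>)"
      using multiplier_bounded by simp
    from choice[OF this] that show thesis by blast
  qed
  \<comment> \<open>Both families of iterates are packed into one, indexed by a flag, a mode and a
    multi-index, so that a single extraction yields a common subsequence.\<close>
  define f where "f n = (\<lambda>(c, i, \<iota>). if c then Y (Suc (q n)) i \<iota> else \<Lambda> (Suc (q n)) i \<iota>)" for n
  define I where "I = (UNIV :: bool set) \<times> {..<length d} \<times> indices d"
  define E where "E = sqrt (energy Xs Ls (Suc 0))"
  have fin: "finite I" by (simp add: I_def finite_indices)
  have f_bound: "\<bar>f n z\<bar> \<le> (case z of (c, i, \<iota>) \<Rightarrow> max (C i \<iota>) (E + \<bar>Xs \<iota>\<bar>))" if "z \<in> I" for n z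
  proof -
    obtain c i \<iota> where z: "z = (c, i, \<iota>)" by (cases z)
    have i: "i < length d" "\<iota> \<in> indices d" using that by (auto simp: I_def z)
    have "(Y (Suc (q n)) i \<iota> - Xs \<iota>)\<^sup>2 \<le> energy Xs Ls (Suc (q n))"
      by (rule Y_dist_le_energy[OF i])
    also have "\<dots> \<le> energy Xs Ls (Suc 0)" using decseqD[OF energy_decseq, of 0 "q n"] by simp
    finally have "sqrt ((Y (Suc (q n)) i \<iota> - Xs \<iota>)\<^sup>2) \<le> E"
      unfolding E_def by (rule real_sqrt_le_mono)
    then show ?thesis using C[OF i, of "q n"] by (auto simp: z f_def)
  qed
  have "\<exists>s l. strict_mono s \<and> (\<forall>z\<in>I. (\<lambda>n. f (s n) z) \<longlonglongrightarrow> l z)"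
    by (rule subsequence_pointwise_convergent[OF fin]) (rule f_bound)
  then obtain s l where s: "strict_mono s" and l: "\<forall>z\<in>I. (\<lambda>n. f (s n) z) \<longlonglongrightarrow> l z"
    by blast
  have s_top: "filterlim s at_top sequentially" by (rule filterlim_subseq[OF s])
  have "convergent (\<lambda>n. Y (Suc (q (s n))) i \<iota>)" "convergent (\<lambda>n. \<Lambda> (Suc (q (s n))) i \<iota>)"
    if i: "i < length d" "\<iota> \<in> indices d" for i \<iota>
  proof -
    have I: "(True, i, \<iota>) \<in> I" "(False, i, \<iota>) \<in> I" using i by (auto simp: I_def)
    have "(\<lambda>n. Y (Suc (q (s n))) i \<iota>) \<longlonglongrightarrow> l (True, i, \<iota>)"
      using bspec[OF l I(1)] by (simp add: f_def)
    then show "convergent (\<lambda>n. Y (Suc (q (s n))) i \<iota>)" by (rule convergentI)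
    have "(\<lambda>n. \<Lambda> (Suc (q (s n))) i \<iota>) \<longlonglongrightarrow> l (False, i, \<iota>)"
      using bspec[OF l I(2)] by (simp add: f_def)
    then show "convergent (\<lambda>n. \<Lambda> (Suc (q (s n))) i \<iota>)" by (rule convergentI)
  qed
  then show ?thesis
    by (intro exI[of _ "\<lambda>n. q (s n)"] conjI allI ballI impI
        filterlim_compose[OF q_top s_top] filterlim_compose[OF gap_q s_top])
qed

end

end

section \<open>Identification of the limit\<close>

context admm begin

theorem iterates_converge:
  assumes "d \<noteq> []" and kkt: "kkt_point d B h Xs Ls"
  shows "\<exists>Xi Li. kkt_point d B h Xi Li \<and>
    (\<forall>\<iota>\<in>indices d. (\<lambda>k. X k \<iota>) \<longlonglongrightarrow> Xi \<iota>) \<and>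
    (\<forall>i<length d. \<forall>\<iota>\<in>indices d. (\<lambda>k. Y k i \<iota>) \<longlonglongrightarrow> Xi \<iota>)"
proof -
  from gap_null_subsequence[OF kkt]
  obtain r where r: "filterlim r at_top sequentially" and gap_r: "(\<lambda>n. gap Xs Ls (r n)) \<longlonglongrightarrow> 0"
    and conv: "\<forall>i<length d. \<forall>\<iota>\<in>indices d.
      convergent (\<lambda>n. Y (Suc (r n)) i \<iota>) \<and> convergent (\<lambda>n. \<Lambda> (Suc (r n)) i \<iota>)"
    by (elim exE conjE)
  have Y_conv: "convergent (\<lambda>n. Y (Suc (r n)) i \<iota>)"
    and \<Lambda>_conv: "convergent (\<lambda>n. \<Lambda> (Suc (r n)) i \<iota>)"
    if "i < length d" "\<iota> \<in> indices d" for i \<iota>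
    using conv[rule_format, OF that] by simp_all
  \<comment> \<open>The default value 0 outside the index set makes the limits tensors and lets
    limits of different modes be equal as functions.\<close>
  define Yi where "Yi i \<iota> = (if \<iota> \<in> indices d then lim (\<lambda>n. Y (Suc (r n)) i \<iota>) else 0)" for i \<iota>
  define Li where "Li i \<iota> = (if \<iota> \<in> indices d then lim (\<lambda>n. \<Lambda> (Suc (r n)) i \<iota>) else 0)" for i \<iota>
  define Xi where "Xi = Yi 0"
  have 0: "0 < length d" using assms(1) by simp
  have B0: "Z \<iota> = 0" if "Z \<in> B" "\<iota> \<notin> indices d" for Z \<iota>
    using that B_tensors by (auto simp: tensors_def)
  have r': "filterlim (\<lambda>n. Suc (r n)) at_top sequentially"
    by (rule filterlim_compose[OF filterlim_Suc r])
  have \<Lambda>_lim: "(\<lambda>n. \<Lambda> (Suc (r n)) i \<iota>) \<longlonglongrightarrow> Li i \<iota>" if "i < length d" "\<iota> \<in> indices d" for i \<iota>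
    using \<Lambda>_conv[OF that] that by (simp add: Li_def convergent_LIMSEQ_iff)
  have Yi_lim: "(\<lambda>n. Y (Suc (r n)) i \<iota>) \<longlonglongrightarrow> Yi i \<iota>" if "i < length d" "\<iota> \<in> indices d" for i \<iota>
    using Y_conv[OF that] that by (simp add: Yi_def convergent_LIMSEQ_iff)
  have step_r: "(\<lambda>n. step_size (r n)) \<longlonglongrightarrow> 0"
    by (rule filterlim_compose[OF step_size_null[OF kkt] r])
  have X_lim_i: "(\<lambda>n. X (Suc (r n)) \<iota>) \<longlonglongrightarrow> Yi i \<iota>" if "i < length d" "\<iota> \<in> indices d" for i \<iota>
    using tendsto_add[OF null_if_square_le_null[OF residuals_le_step_size(2)[OF that] step_r] Yi_lim[OF that]]
    by simp
  have Yi_eq: "Yi i = Xi" if "i < length d" for i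
  proof
    fix \<iota>
    show "Yi i \<iota> = Xi \<iota>"
    proof (cases "\<iota> \<in> indices d")
      case True
      from LIMSEQ_unique[OF X_lim_i[OF that True] X_lim_i[OF 0 True]] show ?thesis by (simp add: Xi_def)
    qed (simp add: Xi_def Yi_def)
  qed
  have Y_lim: "(\<lambda>n. Y (Suc (r n)) i \<iota>) \<longlonglongrightarrow> Xi \<iota>" if "i < length d" "\<iota> \<in> indices d" for i \<iota>
    using Yi_lim[OF that] Yi_eq[OF that(1)] by simp
  have X_lim: "(\<lambda>n. X (Suc (r n)) \<iota>) \<longlonglongrightarrow> Xi \<iota>" for \<iota>
  proof (cases "\<iota> \<in> indices d")
    case True
    then show ?thesis using X_lim_i[OF 0 True] by (simp add: Xi_def)
  next
    case False
    then show ?thesis using B0[OF X_in_B False] by (simp add: Xi_def Yi_def)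
  qed
  have Xi_B: "Xi \<in> B" by (rule pointwise_limit_in_closed[OF closed_B X_in_B X_lim])
  have Xi_T: "Xi \<in> tensors d" and Xs_B: "Xs \<in> B" and Xs_T: "Xs \<in> tensors d"
    using Xi_B kkt B_tensors by (auto simp: kkt_point_def)
  have Li_T: "Li i \<in> tensors d" for i by (simp add: tensors_def Li_def)
  have Li_sub: "(\<lambda>\<iota>. - Li i \<iota>) \<in> subdifferential d (h i) Xi" if "i < length d" for i
    by (rule subdifferential_closed[OF Y_step[OF that] Y_tensor[OF that] Xi_T
          tensors_closed_under(3)[OF Li_T] subdifferentiable[OF that Xi_T]
          tendsto_minus[OF \<Lambda>_lim[OF that]] Y_lim[OF that]])

  \<comment> \<open>Each part lies between zero and the gap, since the other parts are
    nonnegative.\<close>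
  have gap_parts: "(\<lambda>n. gap_Y Xs Ls (r n)) \<longlonglongrightarrow> 0" "(\<lambda>n. gap_X Xs Ls (r n)) \<longlonglongrightarrow> 0"
    by (rule tendsto_sandwich[OF _ _ tendsto_const gap_r];
        use gap_nonneg[OF kkt] in \<open>simp add: gap_def\<close>)+
  have eqY: "(\<Sum>i<length d. tensor_inner d (\<lambda>\<iota>. Ls i \<iota> - Li i \<iota>) (\<lambda>\<iota>. Xi \<iota> - Xs \<iota>)) = 0"
  proof (rule LIMSEQ_unique[OF _ gap_parts(1)])
    show "(\<lambda>n. gap_Y Xs Ls (r n))
      \<longlonglongrightarrow> (\<Sum>i<length d. tensor_inner d (\<lambda>\<iota>. Ls i \<iota> - Li i \<iota>) (\<lambda>\<iota>. Xi \<iota> - Xs \<iota>))"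
      unfolding gap_Y_def
      by (intro tendsto_sum tensor_inner_tendsto tendsto_diff tendsto_const \<Lambda>_lim Y_lim) auto
  qed
  have eqX: "tensor_inner d (\<lambda>\<iota>. \<Sum>i<length d. Ls i \<iota>) (\<lambda>\<iota>. Xs \<iota> - Xi \<iota>) = 0"
  proof (rule LIMSEQ_unique[OF _ gap_parts(2)])
    show "(\<lambda>n. gap_X Xs Ls (r n))
      \<longlonglongrightarrow> tensor_inner d (\<lambda>\<iota>. \<Sum>i<length d. Ls i \<iota>) (\<lambda>\<iota>. Xs \<iota> - Xi \<iota>)"
      unfolding gap_X_def
      by (intro tensor_inner_tendsto tendsto_diff tendsto_const X_lim)
  qed

  \<comment> \<open>Only the quotient by \<beta> has to vanish. This serves both cases below: either
    the numerator tends to zero or the denominator to infinity.\<close>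
  have energy_null: "(\<lambda>n. energy Xi L (Suc (r n))) \<longlonglongrightarrow> 0"
    if "\<And>i \<iota>. i < length d \<Longrightarrow> \<iota> \<in> indices d \<Longrightarrow>
      (\<lambda>n. (\<Lambda> (Suc (r n)) i \<iota> - L i \<iota>) / \<beta> (Suc (r n))) \<longlonglongrightarrow> 0" for L
  proof -
    have "(\<lambda>n. energy Xi L (Suc (r n))) \<longlonglongrightarrow>
      (\<Sum>i<length d. \<Sum>\<iota>\<in>indices d. (Xi \<iota> - Xi \<iota>)\<^sup>2 + 0\<^sup>2)"
      unfolding energy_def power_divide[symmetric]
      by (intro tendsto_sum tendsto_add tendsto_power tendsto_diff tendsto_const Y_lim that) auto
    then show ?thesis by simp
  qed

  have "\<exists>L. kkt_point d B h Xi L \<and> (\<lambda>n. energy Xi L (Suc (r n))) \<longlonglongrightarrow> 0"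
  proof (cases "\<exists>M. \<forall>k. \<beta> k \<le> M")
    case True
    then obtain M where M: "\<And>k. \<beta> k \<le> M" by blast
    have "tensor_inner d (\<lambda>\<iota>. \<Sum>i<length d. Li i \<iota>) (\<lambda>\<iota>. X' \<iota> - Xi \<iota>) \<le> 0" if "X' \<in> B" for X'
    proof (rule LIMSEQ_le_const2)
      \<comment> \<open>The multiplier update trades the new \<open>X\<close> for the new
        \<open>Y\<close>. What remains besides the new multiplier is \<beta> times a null sequence,
        which vanishes for bounded \<beta>.\<close>
      have resid: "\<Lambda> k i \<iota> + \<beta> k * (Y k i \<iota> - X (Suc k) \<iota>)
          = \<Lambda> (Suc k) i \<iota> + \<beta> k * (Y k i \<iota> - Y (Suc k) i \<iota>)" if "i < length d" for k i \<iota>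
        using multiplier_step[OF that, of k \<iota>] by (simp add: algebra_simps)
      have null: "(\<lambda>n. \<beta> (r n) * (Y (r n) i \<iota> - Y (Suc (r n)) i \<iota>)) \<longlonglongrightarrow> 0"
        if "i < length d" "\<iota> \<in> indices d" for i \<iota>
        using null_if_square_le_null[OF residuals_le_step_size(1)[OF that] step_r]
      proof (rule tendsto_0_le)
        show "eventually (\<lambda>n. norm (\<beta> (r n) * (Y (r n) i \<iota> - Y (Suc (r n)) i \<iota>))
            \<le> norm (Y (r n) i \<iota> - Y (Suc (r n)) i \<iota>) * M) sequentially"
          using M beta_pos
          by (intro always_eventually allI) (simp add: abs_mult mult.commute mult_right_mono less_imp_le)
      qed
      have "(\<lambda>n. tensor_inner d
            (\<lambda>\<iota>. \<Sum>i<length d. \<Lambda> (r n) i \<iota> + \<beta> (r n) * (Y (r n) i \<iota> - X (Suc (r n)) \<iota>))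
            (\<lambda>\<iota>. X' \<iota> - X (Suc (r n)) \<iota>))
        \<longlonglongrightarrow> tensor_inner d (\<lambda>\<iota>. \<Sum>i<length d. Li i \<iota> + 0) (\<lambda>\<iota>. X' \<iota> - Xi \<iota>)"
        by (intro tensor_inner_tendsto tendsto_sum tendsto_diff tendsto_const X_lim)
           (use tendsto_add[OF \<Lambda>_lim null] in \<open>auto simp: resid\<close>)
      then show "(\<lambda>n. tensor_inner d
            (\<lambda>\<iota>. \<Sum>i<length d. \<Lambda> (r n) i \<iota> + \<beta> (r n) * (Y (r n) i \<iota> - X (Suc (r n)) \<iota>))
            (\<lambda>\<iota>. X' \<iota> - X (Suc (r n)) \<iota>))
        \<longlonglongrightarrow> tensor_inner d (\<lambda>\<iota>. \<Sum>i<length d. Li i \<iota>) (\<lambda>\<iota>. X' \<iota> - Xi \<iota>)"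
        by simp
      show "\<exists>N. \<forall>n\<ge>N. tensor_inner d
            (\<lambda>\<iota>. \<Sum>i<length d. \<Lambda> (r n) i \<iota> + \<beta> (r n) * (Y (r n) i \<iota> - X (Suc (r n)) \<iota>))
            (\<lambda>\<iota>. X' \<iota> - X (Suc (r n)) \<iota>) \<le> 0"
        using X_step X_in_B that by (simp add: normal_cone_def)
    qed
    then have "kkt_point d B h Xi Li"
      using Xi_B Li_sub tensors_closed_under(5)[of "{..<length d}" Li d] Li_T
      by (simp add: kkt_point_def normal_cone_def)
    moreover have "(\<lambda>n. energy Xi Li (Suc (r n))) \<longlonglongrightarrow> 0"
    proof (rule energy_null)
      fix i \<iota> assume i: "i < length d" "\<iota> \<in> indices d"
      have "(\<lambda>n. \<Lambda> (Suc (r n)) i \<iota> - Li i \<iota>) \<longlonglongrightarrow> 0"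
        using \<Lambda>_lim[OF i] by (simp add: LIM_zero)
      then show "(\<lambda>n. (\<Lambda> (Suc (r n)) i \<iota> - Li i \<iota>) / \<beta> (Suc (r n))) \<longlonglongrightarrow> 0"
      proof (rule tendsto_0_le)
        show "eventually (\<lambda>n. norm ((\<Lambda> (Suc (r n)) i \<iota> - Li i \<iota>) / \<beta> (Suc (r n)))
          \<le> norm (\<Lambda> (Suc (r n)) i \<iota> - Li i \<iota>) * (1 / \<beta> 0)) sequentially"
        proof (intro always_eventually allI)
          fix n
          have "1 / \<beta> (Suc (r n)) \<le> 1 / \<beta> 0"
            using incseqD[OF beta_incseq, of 0 "Suc (r n)"] beta_pos by (intro divide_left_mono) auto
          then show "norm ((\<Lambda> (Suc (r n)) i \<iota> - Li i \<iota>) / \<beta> (Suc (r n)))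
            \<le> norm (\<Lambda> (Suc (r n)) i \<iota> - Li i \<iota>) * (1 / \<beta> 0)"
            using mult_left_mono[of "1 / \<beta> (Suc (r n))" "1 / \<beta> 0" "\<bar>\<Lambda> (Suc (r n)) i \<iota> - Li i \<iota>\<bar>"]
              beta_pos[of "Suc (r n)"] by simp
        qed
      qed
    qed
    ultimately show ?thesis by blast
  next
    \<comment> \<open>A monotone unbounded \<beta> tends to infinity, so the dual part of the energy
      vanishes for any fixed multipliers, in particular for \<open>Ls\<close>. It remains to see
      that \<open>Ls\<close> certifies optimality of \<open>Xi\<close> too.\<close>
    case False
    have "filterlim \<beta> at_top sequentially"
      unfolding filterlim_at_top eventually_sequentially
    proof
      fix Z
      obtain N where "Z \<le> \<beta> N" using False by (meson linear)
      then show "\<exists>N. \<forall>n\<ge>N. Z \<le> \<beta> n" using incseqD[OF beta_incseq] order_trans by blast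
    qed
    then have \<beta>_lim: "filterlim (\<lambda>n. \<beta> (Suc (r n))) at_infinity sequentially"
      by (intro filterlim_at_top_imp_at_infinity filterlim_compose[OF _ r'])
    have "(\<lambda>n. energy Xi Ls (Suc (r n))) \<longlonglongrightarrow> 0"
      by (intro energy_null tendsto_divide_0[OF tendsto_diff[OF \<Lambda>_lim tendsto_const] \<beta>_lim])
    moreover have "kkt_point d B h Xi Ls"
    proof -
      \<comment> \<open>The Bregman distance of \<open>h i\<close> from \<open>Xs\<close> to
        \<open>Xi\<close> with respect to the subgradient \<open>- Ls i\<close>. If it is zero, the
        affine minorant of \<open>h i\<close> at \<open>Xs\<close> also touches at
        \<open>Xi\<close>, so \<open>- Ls i\<close> is a subgradient there.\<close>
      define a where "a i = h i Xi - h i Xs + tensor_inner d (Ls i) (\<lambda>\<iota>. Xi \<iota> - Xs \<iota>)" for i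
      have sub_s: "h i Z \<ge> h i Xs - tensor_inner d (Ls i) (\<lambda>\<iota>. Z \<iota> - Xs \<iota>)"
        if "i < length d" "Z \<in> tensors d" for i Z
        using kkt that by (auto simp: kkt_point_def subdifferential_def tensor_inner_minus_left)
      have a_nonneg: "a i \<ge> 0" if "i < length d" for i
        using sub_s[OF that Xi_T] by (simp add: a_def)
      have "a i \<le> tensor_inner d (\<lambda>\<iota>. Ls i \<iota> - Li i \<iota>) (\<lambda>\<iota>. Xi \<iota> - Xs \<iota>)" if "i < length d" for i
      proof -
        have "h i Xs \<ge> h i Xi - tensor_inner d (Li i) (\<lambda>\<iota>. Xs \<iota> - Xi \<iota>)"
          using Li_sub[OF that] Xs_T by (simp add: subdifferential_def tensor_inner_minus_left)
        then show ?thesis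
          by (simp add: a_def tensor_inner_diff_left tensor_inner_diff_right)
      qed
      \<comment> \<open>The upper bounds come from the subgradients \<open>- Li i\<close> at
        \<open>Xi\<close>, and by \<open>eqY\<close> they sum to zero.\<close>
      then have "(\<Sum>i<length d. a i) \<le> 0"
        unfolding eqY[symmetric] by (intro sum_mono) simp
      then have "(\<Sum>i<length d. a i) = 0"
        by (meson a_nonneg antisym lessThan_iff sum_nonneg)
      then have a0: "a i = 0" if "i < length d" for i
        using that a_nonneg by (subst (asm) sum_nonneg_eq_0_iff) auto
      have "(\<lambda>\<iota>. - Ls i \<iota>) \<in> subdifferential d (h i) Xi" if "i < length d" for i
      proof -
        have "h i Z \<ge> h i Xi - tensor_inner d (Ls i) (\<lambda>\<iota>. Z \<iota> - Xi \<iota>)" if Z: "Z \<in> tensors d" for Z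
          using sub_s[OF \<open>i < length d\<close> Z] a0[OF \<open>i < length d\<close>]
          by (simp add: a_def tensor_inner_diff_right)
        moreover have "(\<lambda>\<iota>. - Ls i \<iota>) \<in> tensors d"
          using kkt that by (simp add: kkt_point_def subdifferential_def)
        ultimately show ?thesis by (simp add: subdifferential_def tensor_inner_minus_left)
      qed
      \<comment> \<open>By \<open>eqX\<close> the functional given by the summed multipliers has the
        same value at \<open>Xs\<close> and \<open>Xi\<close>, so its maximality over
        \<open>B\<close> carries over.\<close>
      moreover have "(\<lambda>\<iota>. \<Sum>i<length d. Ls i \<iota>) \<in> normal_cone d B Xi"
      proof -
        have "(\<lambda>\<iota>. \<Sum>i<length d. Ls i \<iota>) \<in> normal_cone d B Xs" using kkt by (simp add: kkt_point_def)
        then show ?thesis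
          using Xi_B Xs_B eqX by (auto simp: normal_cone_def tensor_inner_diff_right)
      qed
      ultimately show ?thesis using Xi_B by (simp add: kkt_point_def)
    qed
    ultimately show ?thesis by blast
  qed
  then obtain L where L: "kkt_point d B h Xi L" "(\<lambda>n. energy Xi L (Suc (r n))) \<longlonglongrightarrow> 0" by blast
  from converges_if_energy_null_subsequence[OF L(1) r' L(2) assms(1)] L(1)
  show ?thesis by (intro exI[of _ Xi] exI[of _ L]) simp
qed

end

section \<open>Singular value decomposition\<close>

text \<open>Vectors are functions of which the first \<open>n\<close> entries count; on functions
  the product topology provides compactness and continuity.\<close>

definition vdot :: "nat \<Rightarrow> (nat \<Rightarrow> real) \<Rightarrow> (nat \<Rightarrow> real) \<Rightarrow> real" where
  "vdot n x y = (\<Sum>a<n. x a * y a)"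

definition orthonormal :: "nat \<Rightarrow> nat \<Rightarrow> (nat \<Rightarrow> nat \<Rightarrow> real) \<Rightarrow> bool" where
  "orthonormal n r u \<longleftrightarrow> (\<forall>j<r. \<forall>k<r. vdot n (u j) (u k) = of_bool (j = k))"

lemma vdot_commute: "vdot n x y = vdot n y x"
  by (simp add: vdot_def mult.commute)

lemma vdot_sum_right: "vdot n x (\<lambda>a. \<Sum>j\<in>S. y j a) = (\<Sum>j\<in>S. vdot n x (y j))"
  unfolding vdot_def by (subst sum.swap) (simp add: sum_distrib_left)

lemma vdot_scale_right: "vdot n x (\<lambda>a. c * y a) = c * vdot n x y"
  unfolding vdot_def by (simp add: sum_distrib_left mult_ac)

lemma vdot_diff_right: "vdot n x (\<lambda>a. y a - z a) = vdot n x y - vdot n x z"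
  unfolding vdot_def by (simp add: sum_subtractf algebra_simps)

lemma vdot_diff_left: "vdot n (\<lambda>a. y a - z a) x = vdot n y x - vdot n z x"
  unfolding vdot_def by (simp add: sum_subtractf algebra_simps)

lemma vdot_scale_left: "vdot n (\<lambda>a. c * y a) x = c * vdot n y x"
  unfolding vdot_def by (simp add: sum_distrib_left mult_ac)

lemma vdot_self_nonneg: "vdot n x x \<ge> 0"
  unfolding vdot_def by (intro sum_nonneg) auto

lemma vdot_self_eq_0: "vdot n x x = 0 \<Longrightarrow> a < n \<Longrightarrow> x a = 0"
  unfolding vdot_def by (subst (asm) sum_nonneg_eq_0_iff) auto

text \<open>The squared length of \<open>x\<close> minus its projection \<open>w\<close> onto the
  span of the family is nonnegative.\<close>

lemma bessel:
  assumes "orthonormal n r u"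
  shows "(\<Sum>j<r. (vdot n (u j) x)\<^sup>2) \<le> vdot n x x"
proof -
  define p where "p j = vdot n (u j) x" for j
  define w where "w a = (\<Sum>j<r. p j * u j a)" for a
  have xw: "vdot n x w = (\<Sum>j<r. (p j)\<^sup>2)"
    unfolding w_def vdot_sum_right vdot_scale_right
    by (simp add: p_def power2_eq_square vdot_commute[of n x "u _"])
  have uw: "vdot n (u j) w = p j" if "j < r" for j
    unfolding w_def vdot_sum_right vdot_scale_right
    using assms that by (simp add: orthonormal_def)
  have ww: "vdot n w w = (\<Sum>j<r. (p j)\<^sup>2)"
  proof -
    have "vdot n z w = (\<Sum>j<r. p j * vdot n z (u j))" for z
      unfolding w_def vdot_sum_right vdot_scale_right ..
    from this[of w] show ?thesis using uw by (simp add: vdot_commute[of n w "u _"] power2_eq_square)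
  qed
  have "0 \<le> vdot n (\<lambda>a. x a - w a) (\<lambda>a. x a - w a)" by (rule vdot_self_nonneg)
  also have "\<dots> = vdot n x x - (\<Sum>j<r. (p j)\<^sup>2)"
    using vdot_commute[of n w x] xw ww by (simp add: vdot_diff_left vdot_diff_right)
  finally show ?thesis by (simp add: p_def)
qed

text \<open>A matrix with singular values in [0, 1] has spectral norm at most 1. The
  arithmetic-geometric mean inequality separates \<open>x\<close> from \<open>y\<close>, and Bessel
  bounds each half.\<close>

lemma contraction_bilinear_le:
  assumes "orthonormal m r u" "orthonormal n r v" "\<And>j. j < r \<Longrightarrow> 0 \<le> g j \<and> g j \<le> 1"
    and "vdot m x x = 1" "vdot n y y = 1"
  shows "(\<Sum>j<r. g j * (vdot m (u j) x * vdot n (v j) y)) \<le> 1"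
proof -
  have "g j * (vdot m (u j) x * vdot n (v j) y) \<le> ((vdot m (u j) x)\<^sup>2 + (vdot n (v j) y)\<^sup>2) / 2"
    if "j < r" for j
  proof -
    have "g j * (vdot m (u j) x * vdot n (v j) y) \<le> 1 * \<bar>vdot m (u j) x * vdot n (v j) y\<bar>"
      using assms(3)[OF that]
      by (intro order_trans[OF mult_left_mono[OF abs_ge_self] mult_right_mono]) auto
    also have "\<dots> \<le> ((vdot m (u j) x)\<^sup>2 + (vdot n (v j) y)\<^sup>2) / 2"
      using sum_squares_bound[of "\<bar>vdot m (u j) x\<bar>" "\<bar>vdot n (v j) y\<bar>"] by (simp add: abs_mult)
    finally show ?thesis .
  qed
  then have "(\<Sum>j<r. g j * (vdot m (u j) x * vdot n (v j) y))
      \<le> (\<Sum>j<r. ((vdot m (u j) x)\<^sup>2 + (vdot n (v j) y)\<^sup>2) / 2)"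
    by (intro sum_mono) simp
  also have "\<dots> = ((\<Sum>j<r. (vdot m (u j) x)\<^sup>2) + (\<Sum>j<r. (vdot n (v j) y)\<^sup>2)) / 2"
    by (simp add: sum.distrib sum_divide_distrib[symmetric] add_divide_distrib)
  also have "\<dots> \<le> 1"
    using bessel[OF assms(1), of x] bessel[OF assms(2), of y] assms(4,5) by simp
  finally show ?thesis .
qed

text \<open>For a square matrix, a left inverse is a right inverse: orthonormal columns imply
  orthonormal rows.\<close>

lemma orthonormal_basis_complete:
  assumes "orthonormal n n u" "a < n" "b < n"
  shows "(\<Sum>j<n. u j a * u j b) = of_bool (a = b)"
proof -
  define U where "U = mat n n (\<lambda>(a, j). u j a)"
  have U: "U \<in> carrier_mat n n" by (simp add: U_def)
  have "transpose_mat U * U = 1\<^sub>m n"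
    using assms(1) by (intro eq_matI)
      (auto simp: U_def scalar_prod_def orthonormal_def vdot_def atLeast0LessThan)
  then have "U * transpose_mat U = 1\<^sub>m n"
    using mat_mult_left_right_inverse[OF _ U, of "transpose_mat U"] U by simp
  then have "(U * transpose_mat U) $$ (a, b) = of_bool (a = b)" using assms by simp
  then show ?thesis
    using assms by (simp add: U_def scalar_prod_def atLeast0LessThan)
qed

lemma exists_unit_orthogonal:
  fixes u :: "nat \<Rightarrow> nat \<Rightarrow> real"
  assumes "k < n"
  shows "\<exists>x. (\<forall>a\<ge>n. x a = 0) \<and> vdot n x x = 1 \<and> (\<forall>j<k. vdot n (u j) x = 0)"
proof -
  define c where "c i = vec n (u i)" for i
  \<comment> \<open>The zero row k makes \<open>M\<close> singular, and the rows above it turn any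
    kernel vector into one orthogonal to the first k vectors.\<close>
  define M where "M = mat\<^sub>r n n (\<lambda>i. if i = k then 0\<^sub>v n else c i)"
  have M: "M \<in> carrier_mat n n" by (simp add: M_def)
  have "det M = 0" unfolding M_def by (rule det_row_0[OF assms]) (simp add: c_def)
  then obtain w where w: "w \<in> carrier_vec n" "w \<noteq> 0\<^sub>v n" "M *\<^sub>v w = 0\<^sub>v n"
    using det_0_iff_vec_prod_zero_field[OF M] by blast
  define y where "y a = (if a < n then w $ a else 0)" for a
  have orth: "vdot n (u j) y = 0" if "j < k" for j
  proof -
    have "(M *\<^sub>v w) $ j = vdot n (u j) y"
      using that assms w(1)
      by (simp add: M_def c_def scalar_prod_def vdot_def y_def atLeast0LessThan)
    then show ?thesis using w(3) that assms by simp
  qed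
  have "vdot n y y \<noteq> 0"
  proof
    assume "vdot n y y = 0"
    then have "w $ a = 0" if "a < n" for a
      using vdot_self_eq_0[of n y a] that by (simp add: y_def)
    then show False using w(1,2) by (auto intro: eq_vecI)
  qed
  then have pos: "vdot n y y > 0" using vdot_self_nonneg[of n y] by simp
  define x where "x a = (1 / sqrt (vdot n y y)) * y a" for a
  have "vdot n x x = (1 / sqrt (vdot n y y)) * ((1 / sqrt (vdot n y y)) * vdot n y y)"
    unfolding x_def vdot_scale_right vdot_scale_left ..
  then have "vdot n x x = 1" using pos by (simp add: field_simps)
  moreover have "vdot n (u j) x = 0" if "j < k" for j
    unfolding x_def vdot_scale_right using orth[OF that] by simp
  ultimately show ?thesis by (intro exI[of _ x]) (simp add: x_def y_def)
qed

section \<open>Singular vectors by constrained maximization\<close>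

definition unit_orthogonal :: "nat \<Rightarrow> nat \<Rightarrow> (nat \<Rightarrow> nat \<Rightarrow> real) \<Rightarrow> (nat \<Rightarrow> real) set" where
  "unit_orthogonal n k u =
     {x. (\<forall>a\<ge>n. x a = 0) \<and> vdot n x x = 1 \<and> (\<forall>j<k. vdot n (u j) x = 0)}"

lemma continuous_on_vdot:
  assumes "continuous_on S f" "continuous_on S g"
  shows "continuous_on S (\<lambda>z. vdot n (f z) (g z))"
  unfolding vdot_def
  by (intro continuous_on_sum continuous_on_mult
      continuous_on_product_then_coordinatewise[OF assms(1)]
      continuous_on_product_then_coordinatewise[OF assms(2)])

text \<open>Tychonoff for a product of intervals; coordinates with bound 0 are pinned to
  zero.\<close>

lemma compact_coordinate_box:
  fixes C :: "'i \<Rightarrow> real"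
  shows "compact {x. \<forall>i. \<bar>x i\<bar> \<le> C i}"
proof -
  have "compactin (product_topology (\<lambda>i. euclidean) UNIV) (Pi\<^sub>E UNIV (\<lambda>i. {- C i..C i}))"
    by (simp add: compactin_PiE)
  moreover have "Pi\<^sub>E UNIV (\<lambda>i. {- C i..C i}) = {x. \<forall>i. \<bar>x i\<bar> \<le> C i}"
    by (auto simp: PiE_UNIV_domain abs_le_iff minus_le_iff)
  ultimately show ?thesis by (simp add: euclidean_product_topology)
qed

lemma compact_unit_orthogonal: "compact (unit_orthogonal n k u)"
proof -
  let ?K = "{x :: nat \<Rightarrow> real. \<forall>a. \<bar>x a\<bar> \<le> (if a < n then 1 else 0)}"
  let ?C = "{x. vdot n x x = 1} \<inter> (\<Inter>j\<in>{..<k}. {x. vdot n (u j) x = 0})"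
  have "closed ?C"
    by (intro closed_Int closed_INT ballI closed_Collect_eq continuous_on_vdot
        continuous_on_const continuous_on_id)
  moreover have "unit_orthogonal n k u = ?C \<inter> ?K"
  proof -
    have "\<bar>x a\<bar> \<le> 1" if "vdot n x x = 1" "a < n" for x :: "nat \<Rightarrow> real" and a
    proof -
      have "x a * x a \<le> vdot n x x"
        unfolding vdot_def using that by (intro member_le_sum) auto
      then show ?thesis using that by (simp add: abs_square_le_1 power2_eq_square[symmetric])
    qed
    then show ?thesis by (force simp: unit_orthogonal_def not_less split: if_splits)
  qed
  ultimately show ?thesis by (simp only: closed_Int_compact compact_coordinate_box)
qed

text \<open>The equality case of Cauchy-Schwarz. The normalized \<open>z\<close> satisfies the
  constraints, so the length of \<open>z\<close> is at most \<sigma>; then the squared length of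
  \<open>z\<close> minus \<sigma> times \<open>x\<close> is the squared length of \<open>z\<close>
  minus the square of \<sigma>, hence at most zero.\<close>

lemma maximizer_is_parallel:
  assumes max: "\<And>x'. x' \<in> unit_orthogonal n k u \<Longrightarrow> vdot n x' z \<le> \<sigma>"
    and x: "vdot n x x = 1" "vdot n x z = \<sigma>"
    and z: "\<And>j. j < k \<Longrightarrow> vdot n (u j) z = 0" and \<sigma>: "\<sigma> \<ge> 0" and a: "a < n"
  shows "z a = \<sigma> * x a"
proof -
  \<comment> \<open>Truncation, since members of \<open>unit_orthogonal\<close> vanish beyond the
    dimension.\<close>
  define y where "y a = (if a < n then z a else 0)" for a
  have y: "vdot n w y = vdot n w z" for w by (simp add: vdot_def y_def)
  have yy: "vdot n y y = vdot n z z" by (simp add: vdot_def y_def)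
  have le: "vdot n z z \<le> \<sigma>\<^sup>2"
  proof (cases "vdot n z z = 0")
    case False
    then have pos: "vdot n z z > 0" using vdot_self_nonneg[of n z] by simp
    define c where "c = 1 / sqrt (vdot n z z)"
    have zz: "vdot n (\<lambda>a. c * y a) z = c * vdot n z z"
      using vdot_commute[of n y z] by (simp add: vdot_scale_left y)
    have cc: "c * (c * vdot n z z) = 1" using pos by (simp add: c_def)
    have "(\<lambda>a. c * y a) \<in> unit_orthogonal n k u"
      unfolding unit_orthogonal_def
      using z cc zz by (simp add: vdot_scale_right y) (simp add: y_def)
    from max[OF this] have "c * vdot n z z \<le> \<sigma>" using zz by simp
    moreover have "c * vdot n z z = sqrt (vdot n z z)"
      using pos real_div_sqrt[of "vdot n z z"] by (simp add: c_def)
    ultimately show ?thesis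
      using sqrt_le_D by auto
  qed simp
  have "vdot n (\<lambda>a. z a - \<sigma> * x a) (\<lambda>a. z a - \<sigma> * x a) = vdot n z z - \<sigma>\<^sup>2"
    using vdot_commute[of n z x] x
    by (simp add: vdot_diff_left vdot_diff_right vdot_scale_left vdot_scale_right power2_eq_square)
  then have "vdot n (\<lambda>a. z a - \<sigma> * x a) (\<lambda>a. z a - \<sigma> * x a) = 0"
    using le vdot_self_nonneg[of n "\<lambda>a. z a - \<sigma> * x a"] by simp
  from vdot_self_eq_0[OF this a] show ?thesis by simp
qed

text \<open>A partial singular value decomposition. The relations for \<open>M\<close> and for its
  transpose are both recorded, as the induction uses each to preserve the orthogonality on one
  side.\<close>

definition singular_system ::
  "nat \<Rightarrow> nat \<Rightarrow> nat \<Rightarrow> (nat \<Rightarrow> nat \<Rightarrow> real) \<Rightarrow>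
     (nat \<Rightarrow> nat \<Rightarrow> real) \<Rightarrow> (nat \<Rightarrow> real) \<Rightarrow> (nat \<Rightarrow> nat \<Rightarrow> real) \<Rightarrow> bool" where
  "singular_system m n k M u s v \<longleftrightarrow> orthonormal m k u \<and> orthonormal n k v \<and>
     (\<forall>j<k. s j \<ge> 0 \<and> (\<forall>a<m. vdot n (M a) (v j) = s j * u j a) \<and>
       (\<forall>b<n. vdot m (\<lambda>a. M a b) (u j) = s j * v j b))"

lemma vdot_bilinear_swap:
  "vdot m x (\<lambda>a. vdot n (M a) y) = vdot n y (\<lambda>b. vdot m (\<lambda>a. M a b) x)"
  unfolding vdot_def sum_distrib_left by (subst sum.swap) (simp add: mult_ac)

lemma orthonormal_extend:
  assumes "orthonormal n k u" "x \<in> unit_orthogonal n k u"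
  shows "orthonormal n (Suc k) (u(k := x))"
  using assms by (auto simp: orthonormal_def unit_orthogonal_def less_Suc_eq vdot_commute[of n x "u _"])

text \<open>Maximizes the bilinear form of \<open>M\<close> over unit vectors orthogonal to those
  already found. At a maximizer, \<open>M\<close> applied to \<open>y\<close> and the transpose
  applied to \<open>x\<close> satisfy the same orthogonality constraints, so they are parallel to
  \<open>x\<close> and \<open>y\<close>, both with factor \<sigma>.\<close>

lemma singular_system_extend:
  assumes sys: "singular_system m n k M u s v" and "k < m" "k < n"
  shows "\<exists>u' s' v'. singular_system m n (Suc k) M u' s' v'"
proof -
  let ?S = "unit_orthogonal m k u" and ?T = "unit_orthogonal n k v"
  define f where "f p = vdot m (fst p) (\<lambda>a. vdot n (M a) (snd p))" for p
  have "continuous_on (?S \<times> ?T) f"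
    unfolding f_def
    by (rule continuous_on_vdot, rule continuous_on_fst[OF continuous_on_id],
        rule continuous_on_coordinatewise_then_product, rule continuous_on_vdot,
        rule continuous_on_const, rule continuous_on_snd[OF continuous_on_id])
  moreover have "compact (?S \<times> ?T)" by (intro compact_Times compact_unit_orthogonal)
  moreover have "?S \<times> ?T \<noteq> {}"
    using exists_unit_orthogonal[OF assms(2), of u] exists_unit_orthogonal[OF assms(3), of v]
    by (auto simp: unit_orthogonal_def)
  ultimately obtain p where p: "p \<in> ?S \<times> ?T" "\<forall>q\<in>?S \<times> ?T. f q \<le> f p"
    using continuous_attains_sup by blast
  obtain x y where xy: "p = (x, y)" by (cases p)
  have x: "x \<in> ?S" and y: "y \<in> ?T" using p(1) by (auto simp: xy)
  define \<sigma> where "\<sigma> = vdot m x (\<lambda>a. vdot n (M a) y)"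
  have max: "vdot m x' (\<lambda>a. vdot n (M a) y') \<le> \<sigma>" if "x' \<in> ?S" "y' \<in> ?T" for x' y'
    using bspec[OF p(2), of "(x', y')"] that by (simp add: f_def xy \<sigma>_def)
  have max': "vdot n y' (\<lambda>b. vdot m (\<lambda>a. M a b) x) \<le> \<sigma>" if "y' \<in> ?T" for y'
    using max[OF x that] by (subst vdot_bilinear_swap[symmetric])
  have \<sigma>': "\<sigma> = vdot n y (\<lambda>b. vdot m (\<lambda>a. M a b) x)"
    unfolding \<sigma>_def by (rule vdot_bilinear_swap)
  have neg: "vdot l (\<lambda>a. - w a) t = - vdot l w t" "vdot l w (\<lambda>a. - t a) = - vdot l w t" for l w t
    by (simp_all add: vdot_def sum_negf)
  \<comment> \<open>Flipping the sign of \<open>x\<close> stays feasible and negates the value, so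
    the maximum is nonnegative.\<close>
  have "(\<lambda>a. - x a) \<in> ?S" using x by (simp add: unit_orthogonal_def neg)
  from max[OF this y] have \<sigma>_nonneg: "\<sigma> \<ge> 0" by (simp add: neg \<sigma>_def)
  have Mv: "vdot n (M a) y = \<sigma> * x a" if "a < m" for a
  proof (rule maximizer_is_parallel[where z = "\<lambda>a. vdot n (M a) y", OF _ _ _ _ \<sigma>_nonneg that])
    fix j assume j: "j < k"
    \<comment> \<open>The transpose maps an earlier left vector to a multiple of its partner, to
      which \<open>y\<close> is orthogonal.\<close>
    have "vdot m (u j) (\<lambda>a. vdot n (M a) y) = vdot n y (\<lambda>b. s j * v j b)"
      by (subst vdot_bilinear_swap) (use sys j in \<open>simp add: singular_system_def vdot_def\<close>)
    then show "vdot m (u j) (\<lambda>a. vdot n (M a) y) = 0"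
      using y j by (simp add: vdot_scale_right unit_orthogonal_def vdot_commute[of n y "v j"])
  qed (use max[OF _ y] x in \<open>auto simp: \<sigma>_def unit_orthogonal_def\<close>)
  have Mu: "vdot m (\<lambda>a. M a b) x = \<sigma> * y b" if "b < n" for b
  proof (rule maximizer_is_parallel[where z = "\<lambda>b. vdot m (\<lambda>a. M a b) x", OF _ _ _ _ \<sigma>_nonneg that])
    fix j assume j: "j < k"
    have "vdot n (v j) (\<lambda>b. vdot m (\<lambda>a. M a b) x) = vdot m x (\<lambda>a. s j * u j a)"
      by (subst vdot_bilinear_swap[symmetric]) (use sys j in \<open>simp add: singular_system_def vdot_def\<close>)
    then show "vdot n (v j) (\<lambda>b. vdot m (\<lambda>a. M a b) x) = 0"
      using x j by (simp add: vdot_scale_right unit_orthogonal_def vdot_commute[of m x "u j"])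
  qed (use max' y in \<open>auto simp: \<sigma>' unit_orthogonal_def\<close>)
  have "singular_system m n (Suc k) M (u(k := x)) (s(k := \<sigma>)) (v(k := y))"
    using sys orthonormal_extend[OF _ x] orthonormal_extend[OF _ y] Mv Mu \<sigma>_nonneg
    by (auto simp: singular_system_def less_Suc_eq)
  then show ?thesis by blast
qed

lemma singular_system_exists:
  "k \<le> min m n \<Longrightarrow> \<exists>u s v. singular_system m n k M u s v"
proof (induction k)
  case 0
  then show ?case by (simp add: singular_system_def orthonormal_def)
next
  case (Suc k)
  then show ?case using singular_system_extend[of m n k M] by fastforce
qed

lemma singular_value_decomposition:
  "\<exists>u s v. orthonormal m (min m n) u \<and> orthonormal n (min m n) v \<and> (\<forall>j<min m n. s j \<ge> 0) \<and>
     (\<forall>a<m. \<forall>b<n. M a b = (\<Sum>j<min m n. u j a * s j * v j b))"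
proof -
  obtain u s v where sys: "singular_system m n (min m n) M u s v"
    using singular_system_exists[of "min m n" m n M] by auto
  have "M a b = (\<Sum>j<min m n. u j a * s j * v j b)" if a: "a < m" and b: "b < n" for a b
  \<comment> \<open>The smaller dimension is the side on which the singular vectors form a full
    basis; expanding \<open>M\<close> in that basis reconstructs it.\<close>
  proof (cases "m \<le> n")
    case True
    then have r: "min m n = m" by simp
    have "(\<Sum>j<m. u j a * s j * v j b) = (\<Sum>j<m. u j a * vdot m (\<lambda>a. M a b) (u j))"
      using sys b by (intro sum.cong) (auto simp: singular_system_def r)
    also have "\<dots> = (\<Sum>c<m. M c b * (\<Sum>j<m. u j a * u j c))"
      unfolding vdot_def sum_distrib_left by (subst sum.swap) (simp add: mult_ac)
    also have "\<dots> = (\<Sum>c<m. M c b * of_bool (a = c))"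
      using sys a by (intro sum.cong)
        (auto simp: singular_system_def r orthonormal_basis_complete)
    also have "\<dots> = M a b" using a by (simp add: of_bool_def if_distrib cong: if_cong)
    finally show ?thesis by (simp add: r)
  next
    case False
    then have r: "min m n = n" by simp
    have "(\<Sum>j<n. u j a * s j * v j b) = (\<Sum>j<n. v j b * vdot n (M a) (v j))"
      using sys a by (intro sum.cong) (auto simp: singular_system_def r)
    also have "\<dots> = (\<Sum>c<n. M a c * (\<Sum>j<n. v j b * v j c))"
      unfolding vdot_def sum_distrib_left by (subst sum.swap) (simp add: mult_ac)
    also have "\<dots> = (\<Sum>c<n. M a c * of_bool (b = c))"
      using sys b by (intro sum.cong)
        (auto simp: singular_system_def r orthonormal_basis_complete)
    also have "\<dots> = M a b" using b by (simp add: of_bool_def if_distrib cong: if_cong)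
    finally show ?thesis by (simp add: r)
  qed
  then show ?thesis
    using sys by (intro exI[of _ u] exI[of _ s] exI[of _ v]) (auto simp: singular_system_def)
qed

section \<open>The nuclear norm and singular value thresholding\<close>

definition dyads ::
  "nat \<Rightarrow> (nat \<Rightarrow> nat \<Rightarrow> real) \<Rightarrow> (nat \<Rightarrow> real) \<Rightarrow> (nat \<Rightarrow> nat \<Rightarrow> real) \<Rightarrow> nat \<Rightarrow> nat \<Rightarrow> real" where
  "dyads r u g v a b = (\<Sum>j<r. u j a * g j * v j b)"

definition entry_inner ::
  "nat \<Rightarrow> nat \<Rightarrow> (nat \<Rightarrow> nat \<Rightarrow> real) \<Rightarrow> (nat \<Rightarrow> nat \<Rightarrow> real) \<Rightarrow> real" where
  "entry_inner m n G Z = (\<Sum>a<m. \<Sum>b<n. G a b * Z a b)"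

lemma entry_inner_cong:
  "(\<And>a b. a < m \<Longrightarrow> b < n \<Longrightarrow> G a b = G' a b) \<Longrightarrow> (\<And>a b. a < m \<Longrightarrow> b < n \<Longrightarrow> Z a b = Z' a b) \<Longrightarrow>
    entry_inner m n G Z = entry_inner m n G' Z'"
  unfolding entry_inner_def by (intro sum.cong) auto

lemma entry_inner_add_right:
  "entry_inner m n G (\<lambda>a b. Y a b + Z a b) = entry_inner m n G Y + entry_inner m n G Z"
  by (simp add: entry_inner_def sum.distrib algebra_simps)

lemma entry_inner_diff_right:
  "entry_inner m n G (\<lambda>a b. Y a b - Z a b) = entry_inner m n G Y - entry_inner m n G Z"
  by (simp add: entry_inner_def sum_subtractf algebra_simps)

lemma entry_inner_rank_one:
  "entry_inner m n (\<lambda>a b. x a * c * y b) (\<lambda>a b. x' a * c' * y' b) = c * c' * (vdot m x x' * vdot n y y')"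
  unfolding entry_inner_def vdot_def sum_product
  unfolding sum_distrib_left
  by (intro sum.cong refl) (simp add: mult_ac)

lemma entry_inner_sum:
  "entry_inner m n (\<lambda>a b. \<Sum>j\<in>S. G j a b) (\<lambda>a b. \<Sum>l\<in>T. Z l a b)
    = (\<Sum>l\<in>T. \<Sum>j\<in>S. entry_inner m n (G j) (Z l))"
proof -
  have "entry_inner m n (\<lambda>a b. \<Sum>j\<in>S. G j a b) (\<lambda>a b. \<Sum>l\<in>T. Z l a b)
      = (\<Sum>a<m. \<Sum>b<n. \<Sum>l\<in>T. \<Sum>j\<in>S. G j a b * Z l a b)"
    unfolding entry_inner_def sum_product by (subst sum.swap[of _ T S]) simp
  also have "\<dots> = (\<Sum>a<m. \<Sum>l\<in>T. \<Sum>j\<in>S. \<Sum>b<n. G j a b * Z l a b)"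
    by (simp only: sum.swap[of _ T "{..<n}"] sum.swap[of _ S "{..<n}"])
  also have "\<dots> = (\<Sum>l\<in>T. \<Sum>j\<in>S. \<Sum>a<m. \<Sum>b<n. G j a b * Z l a b)"
    by (simp only: sum.swap[of _ T "{..<m}"] sum.swap[of _ S "{..<m}"])
  finally show ?thesis by (simp add: entry_inner_def)
qed

lemma entry_inner_dyads:
  "entry_inner m n (dyads r u g v) (dyads r' u' s v')
    = (\<Sum>l<r'. s l * (\<Sum>j<r. g j * (vdot m (u j) (u' l) * vdot n (v j) (v' l))))"
  unfolding dyads_def entry_inner_sum entry_inner_rank_one sum_distrib_left
  by (intro sum.cong refl) (simp add: mult_ac)

text \<open>Duality of spectral and nuclear norm: each dyad of the second factor, stripped of its
  weight, pairs with the contraction to at most 1.\<close>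

lemma entry_inner_dyads_le:
  assumes "orthonormal m r u" "orthonormal n r v" "\<And>j. j < r \<Longrightarrow> 0 \<le> g j \<and> g j \<le> 1"
    and "orthonormal m r' u'" "orthonormal n r' v'" "\<And>l. l < r' \<Longrightarrow> 0 \<le> s l"
  shows "entry_inner m n (dyads r u g v) (dyads r' u' s v') \<le> (\<Sum>l<r'. s l)"
  unfolding entry_inner_dyads
proof (intro sum_mono)
  fix l assume "l \<in> {..<r'}"
  then have l: "l < r'" by simp
  have "(\<Sum>j<r. g j * (vdot m (u j) (u' l) * vdot n (v j) (v' l))) \<le> 1"
    using assms(4,5) l
    by (intro contraction_bilinear_le[OF assms(1,2,3)]) (auto simp: orthonormal_def)
  then show "s l * (\<Sum>j<r. g j * (vdot m (u j) (u' l) * vdot n (v j) (v' l))) \<le> s l"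
    using assms(6)[OF l] by (simp add: mult_left_le)
qed

lemma entry_inner_dyads_same:
  assumes "orthonormal m r u" "orthonormal n r v"
  shows "entry_inner m n (dyads r u g v) (dyads r u s v) = (\<Sum>l<r. g l * s l)"
  unfolding entry_inner_dyads
proof (intro sum.cong refl)
  fix l assume "l \<in> {..<r}"
  then have "(\<Sum>j<r. g j * (vdot m (u j) (u l) * vdot n (v j) (v l))) = (\<Sum>j<r. if j = l then g j else 0)"
    using assms by (intro sum.cong) (auto simp: orthonormal_def)
  then show "s l * (\<Sum>j<r. g j * (vdot m (u j) (u l) * vdot n (v j) (v l))) = g l * s l"
    using \<open>l \<in> {..<r}\<close> by simp
qed

section \<open>Matrices and the nuclear norm\<close>

abbreviation entries :: "real mat \<Rightarrow> nat \<Rightarrow> nat \<Rightarrow> real" where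
  "entries X \<equiv> \<lambda>a b. X $$ (a, b)"

abbreviation columns :: "real mat \<Rightarrow> nat \<Rightarrow> nat \<Rightarrow> real" where
  "columns U \<equiv> \<lambda>j a. U $$ (a, j)"

lemma orthonormal_columns_iff:
  assumes "U \<in> carrier_mat m r"
  shows "transpose_mat U * U = 1\<^sub>m r \<longleftrightarrow> orthonormal m r (columns U)"
proof -
  have "(transpose_mat U * U) $$ (j, k) = vdot m (columns U j) (columns U k)" if "j < r" "k < r" for j k
    using assms that by (simp add: scalar_prod_def vdot_def atLeast0LessThan)
  moreover have "transpose_mat U * U \<in> carrier_mat r r" using assms by simp
  ultimately show ?thesis
    unfolding orthonormal_def by (auto simp: mat_eq_iff)
qed

lemma svd_product_entry:
  assumes "U \<in> carrier_mat m r" "V \<in> carrier_mat n r" "a < m" "b < n"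
  shows "(U * mat_diag r g * transpose_mat V) $$ (a, b) = dyads r (columns U) g (columns V) a b"
  using assms
  by (simp add: mat_diag_mult_right[OF assms(1)] scalar_prod_def dyads_def atLeast0LessThan)

lemma is_svd_iff:
  assumes X: "X \<in> carrier_mat m n" and r: "r = min m n"
  shows "is_svd X U s V \<longleftrightarrow> U \<in> carrier_mat m r \<and> V \<in> carrier_mat n r \<and> length s = r \<and>
    orthonormal m r (columns U) \<and> orthonormal n r (columns V) \<and> (\<forall>j<r. 0 \<le> s ! j) \<and>
    (\<forall>a<m. \<forall>b<n. X $$ (a, b) = dyads r (columns U) (\<lambda>j. s ! j) (columns V) a b)"
proof -
  have "X = U * mat_diag r (\<lambda>j. s ! j) * transpose_mat V \<longleftrightarrow>
    (\<forall>a<m. \<forall>b<n. X $$ (a, b) = dyads r (columns U) (\<lambda>j. s ! j) (columns V) a b)"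
    if "U \<in> carrier_mat m r" "V \<in> carrier_mat n r"
    using X that svd_product_entry[OF that] by (auto simp: mat_eq_iff)
  then show ?thesis
    using X unfolding is_svd_def Let_def r
    by (auto simp: orthonormal_columns_iff all_set_conv_all_nth)
qed

lemma some_svd:
  assumes X: "X \<in> carrier_mat m n" and eq: "some_svd X = (U, s, V)"
  shows "is_svd X U s V"
proof -
  define r where "r = min m n"
  obtain u \<sigma> v where svd: "orthonormal m r u" "orthonormal n r v" "\<forall>j<r. \<sigma> j \<ge> 0"
    "\<forall>a<m. \<forall>b<n. X $$ (a, b) = (\<Sum>j<r. u j a * \<sigma> j * v j b)"
    using singular_value_decomposition[of m n "entries X"] unfolding r_def by blast
  define U' where "U' = mat m r (\<lambda>(a, j). u j a)"
  define V' where "V' = mat n r (\<lambda>(b, j). v j b)"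
  have "vdot m (columns U' j) (columns U' k) = vdot m (u j) (u k)" if "j < r" "k < r" for j k
    using that by (simp add: vdot_def U'_def)
  moreover have "vdot n (columns V' j) (columns V' k) = vdot n (v j) (v k)" if "j < r" "k < r" for j k
    using that by (simp add: vdot_def V'_def)
  ultimately have "orthonormal m r (columns U')" "orthonormal n r (columns V')"
    using svd(1,2) by (simp_all add: orthonormal_def)
  moreover have "dyads r (columns U') (\<lambda>j. map \<sigma> [0..<r] ! j) (columns V') a b = X $$ (a, b)"
    if "a < m" "b < n" for a b
    using svd(4) that by (simp add: dyads_def U'_def V'_def)
  ultimately have "is_svd X U' (map \<sigma> [0..<r]) V'"
    unfolding is_svd_iff[OF X r_def] using svd(3) by (auto simp: U'_def V'_def)
  then have "\<exists>p. case p of (U, s, V) \<Rightarrow> is_svd X U s V" by blast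
  from someI_ex[OF this] show ?thesis using eq by (simp add: some_svd_def)
qed

lemma nuclear_norm_attained:
  assumes X: "X \<in> carrier_mat m n"
  obtains r u s v where "orthonormal m r u" "orthonormal n r v" "\<And>j. j < r \<Longrightarrow> 0 \<le> s j"
    "\<And>a b. a < m \<Longrightarrow> b < n \<Longrightarrow> X $$ (a, b) = dyads r u s v a b"
    "nuclear_norm X = (\<Sum>j<r. s j)"
proof -
  define r where "r = min m n"
  obtain U s V where eq: "some_svd X = (U, s, V)" by (cases "some_svd X")
  have svd: "is_svd X U s V" by (rule some_svd[OF X eq])
  have "nuclear_norm X = (\<Sum>j<r. s ! j)"
    using svd unfolding is_svd_iff[OF X r_def]
    by (simp add: nuclear_norm_def eq sum_list_sum_nth atLeast0LessThan)
  then show thesis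
    using that[of r "columns U" "columns V" "\<lambda>j. s ! j"] svd unfolding is_svd_iff[OF X r_def]
    by blast
qed

lemma nuclear_norm_ge:
  assumes X: "X \<in> carrier_mat m n"
    and "orthonormal m r u" "orthonormal n r v" "\<And>j. j < r \<Longrightarrow> 0 \<le> g j \<and> g j \<le> 1"
  shows "entry_inner m n (dyads r u g v) (entries X) \<le> nuclear_norm X"
proof -
  obtain r' u' s v' where svd: "orthonormal m r' u'" "orthonormal n r' v'"
    "\<And>j. j < r' \<Longrightarrow> 0 \<le> s j"
    "\<And>a b. a < m \<Longrightarrow> b < n \<Longrightarrow> X $$ (a, b) = dyads r' u' s v' a b"
    "nuclear_norm X = (\<Sum>j<r'. s j)"
    using nuclear_norm_attained[OF X] by metis
  have "entry_inner m n (dyads r u g v) (entries X)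
      = entry_inner m n (dyads r u g v) (dyads r' u' s v')"
    by (rule entry_inner_cong) (simp_all add: svd(4))
  also have "\<dots> \<le> (\<Sum>j<r'. s j)"
    by (rule entry_inner_dyads_le[OF assms(2-4) svd(1-3)])
  finally show ?thesis using svd(5) by simp
qed

text \<open>Independence of the chosen decomposition, even of its number of terms. Each sum of
  singular values is attained by pairing with the partial isometry of its own decomposition, and
  that pairing is bounded by the sum of any other.\<close>

lemma nuclear_norm_eq:
  assumes X: "X \<in> carrier_mat m n" and u: "orthonormal m r u" and v: "orthonormal n r v"
    and s: "\<And>j. j < r \<Longrightarrow> 0 \<le> s j"
    and entry: "\<And>a b. a < m \<Longrightarrow> b < n \<Longrightarrow> X $$ (a, b) = dyads r u s v a b"
  shows "nuclear_norm X = (\<Sum>j<r. s j)"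
proof (rule antisym)
  have "(\<Sum>j<r. s j) = entry_inner m n (dyads r u (\<lambda>_. 1) v) (dyads r u s v)"
    using entry_inner_dyads_same[OF u v] by simp
  also have "\<dots> = entry_inner m n (dyads r u (\<lambda>_. 1) v) (entries X)"
    by (rule entry_inner_cong) (simp_all add: entry)
  also have "\<dots> \<le> nuclear_norm X" by (rule nuclear_norm_ge[OF X u v]) simp
  finally show "(\<Sum>j<r. s j) \<le> nuclear_norm X" .
  obtain r' u' s' v' where svd: "orthonormal m r' u'" "orthonormal n r' v'"
    "\<And>j. j < r' \<Longrightarrow> 0 \<le> s' j"
    "\<And>a b. a < m \<Longrightarrow> b < n \<Longrightarrow> X $$ (a, b) = dyads r' u' s' v' a b"
    "nuclear_norm X = (\<Sum>j<r'. s' j)"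
    using nuclear_norm_attained[OF X] by metis
  have "nuclear_norm X = entry_inner m n (dyads r' u' (\<lambda>_. 1) v') (dyads r' u' s' v')"
    using entry_inner_dyads_same[OF svd(1,2)] svd(5) by simp
  also have "\<dots> = entry_inner m n (dyads r' u' (\<lambda>_. 1) v') (dyads r u s v)"
    by (rule entry_inner_cong) (simp_all add: entry svd(4)[symmetric])
  also have "\<dots> \<le> (\<Sum>j<r. s j)"
    by (rule entry_inner_dyads_le[OF svd(1,2) _ u v s]) auto
  finally show "nuclear_norm X \<le> (\<Sum>j<r. s j)" .
qed

text \<open>The condition linking \<open>g\<close> and \<open>s\<close> is complementary slackness:
  \<open>g\<close> equals 1 wherever \<open>s\<close> is positive, so the contraction attains the
  nuclear norm at \<open>Y\<close>, while it stays below the nuclear norm at every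
  \<open>Z\<close>.\<close>

lemma nuclear_norm_subgradient:
  assumes Y: "Y \<in> carrier_mat m n" and Z: "Z \<in> carrier_mat m n"
    and u: "orthonormal m r u" and v: "orthonormal n r v"
    and g: "\<And>j. j < r \<Longrightarrow> 0 \<le> g j \<and> g j \<le> 1" and s: "\<And>j. j < r \<Longrightarrow> 0 \<le> s j \<and> g j * s j = s j"
    and entry: "\<And>a b. a < m \<Longrightarrow> b < n \<Longrightarrow> Y $$ (a, b) = dyads r u s v a b"
  shows "nuclear_norm Y + entry_inner m n (dyads r u g v) (\<lambda>a b. Z $$ (a, b) - Y $$ (a, b)) \<le> nuclear_norm Z"
proof -
  have "entry_inner m n (dyads r u g v) (entries Y) = entry_inner m n (dyads r u g v) (dyads r u s v)"
    by (rule entry_inner_cong) (simp_all add: entry)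
  also have "\<dots> = (\<Sum>j<r. s j)"
    unfolding entry_inner_dyads_same[OF u v] by (intro sum.cong refl) (simp add: s)
  also have "\<dots> = nuclear_norm Y" by (rule nuclear_norm_eq[OF Y u v _ entry, symmetric]) (simp_all add: s)
  finally show ?thesis
    using nuclear_norm_ge[OF Z u v g] by (simp add: entry_inner_diff_right)
qed

lemma nuclear_norm_subdifferentiable:
  assumes Y: "Y \<in> carrier_mat m n"
  shows "\<exists>G. \<forall>Z\<in>carrier_mat m n.
    nuclear_norm Y + entry_inner m n G (\<lambda>a b. Z $$ (a, b) - Y $$ (a, b)) \<le> nuclear_norm Z"
proof -
  obtain r u s v where svd: "orthonormal m r u" "orthonormal n r v"
    "\<And>j. j < r \<Longrightarrow> 0 \<le> s j"
    "\<And>a b. a < m \<Longrightarrow> b < n \<Longrightarrow> Y $$ (a, b) = dyads r u s v a b"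
    using nuclear_norm_attained[OF Y] by metis
  have "nuclear_norm Y + entry_inner m n (dyads r u (\<lambda>_. 1) v) (\<lambda>a b. Z $$ (a, b) - Y $$ (a, b)) \<le> nuclear_norm Z"
    if "Z \<in> carrier_mat m n" for Z
    by (rule nuclear_norm_subgradient[OF Y that svd(1,2)]) (simp_all add: svd(3,4))
  then show ?thesis by blast
qed

lemma nuclear_norm_add_le:
  assumes Y: "Y \<in> carrier_mat m n" and Z: "Z \<in> carrier_mat m n"
  shows "nuclear_norm (Y + Z) \<le> nuclear_norm Y + nuclear_norm Z"
proof -
  have YZ: "Y + Z \<in> carrier_mat m n" using Y Z by simp
  obtain r u s v where svd: "orthonormal m r u" "orthonormal n r v"
    "\<And>j. j < r \<Longrightarrow> 0 \<le> s j"
    "\<And>a b. a < m \<Longrightarrow> b < n \<Longrightarrow> (Y + Z) $$ (a, b) = dyads r u s v a b"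
    "nuclear_norm (Y + Z) = (\<Sum>j<r. s j)"
    using nuclear_norm_attained[OF YZ] by metis
  have "nuclear_norm (Y + Z) = entry_inner m n (dyads r u (\<lambda>_. 1) v) (dyads r u s v)"
    using entry_inner_dyads_same[OF svd(1,2)] svd(5) by simp
  also have "\<dots> = entry_inner m n (dyads r u (\<lambda>_. 1) v) (\<lambda>a b. Y $$ (a, b) + Z $$ (a, b))"
    by (rule entry_inner_cong) (use Y Z in \<open>simp_all add: svd(4)[symmetric]\<close>)
  also have "\<dots> \<le> nuclear_norm Y + nuclear_norm Z"
    unfolding entry_inner_add_right
    by (intro add_mono nuclear_norm_ge[OF Y svd(1,2)] nuclear_norm_ge[OF Z svd(1,2)]) auto
  finally show ?thesis .
qed

lemma sv_threshold_carrier: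
  assumes X: "X \<in> carrier_mat m n"
  shows "sv_threshold \<tau> X \<in> carrier_mat m n"
proof -
  obtain U s V where eq: "some_svd X = (U, s, V)" by (cases "some_svd X")
  have U: "U \<in> carrier_mat m (min m n)" and V: "V \<in> carrier_mat n (min m n)" and s: "length s = min m n"
    using some_svd[OF X eq] unfolding is_svd_iff[OF X refl] by auto
  show ?thesis
    unfolding sv_threshold_def eq prod.case s
    by (rule mult_carrier_mat[OF mult_carrier_mat[OF U mat_diag_dim]]) (use V in simp)
qed

text \<open>Optimality of \<open>Y\<close> for the proximal problem of the nuclear norm at
  \<open>X\<close>: thresholding preserves the singular vectors, so the scaled residual is again a
  sum of the same dyads.\<close>

lemma sv_threshold_subgradient:
  assumes X: "X \<in> carrier_mat m n" and Z: "Z \<in> carrier_mat m n" and \<tau>: "\<tau> > 0"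
    and Y: "Y = sv_threshold \<tau> X"
  shows "nuclear_norm Y + entry_inner m n (\<lambda>a b. (X $$ (a, b) - Y $$ (a, b)) / \<tau>)
    (\<lambda>a b. Z $$ (a, b) - Y $$ (a, b)) \<le> nuclear_norm Z"
proof -
  define r where "r = min m n"
  obtain U s V where eq: "some_svd X = (U, s, V)" by (cases "some_svd X")
  have svd: "U \<in> carrier_mat m r" "V \<in> carrier_mat n r" "length s = r"
    "orthonormal m r (columns U)" "orthonormal n r (columns V)" "\<forall>j<r. 0 \<le> s ! j"
    "\<forall>a<m. \<forall>b<n. X $$ (a, b) = dyads r (columns U) (\<lambda>j. s ! j) (columns V) a b"
    using some_svd[OF X eq] unfolding is_svd_iff[OF X r_def] by auto
  define y where "y j = max (s ! j - \<tau>) 0" for j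
  \<comment> \<open>In closed form the minimum of \<open>s ! j / \<tau>\<close> and 1, which is 1
    exactly where the thresholded value can be positive.\<close>
  define g where "g j = (s ! j - y j) / \<tau>" for j
  have Yc: "Y \<in> carrier_mat m n" unfolding Y by (rule sv_threshold_carrier[OF X])
  have Y_entry: "Y $$ (a, b) = dyads r (columns U) y (columns V) a b" if "a < m" "b < n" for a b
    using svd_product_entry[OF svd(1,2) that, of y]
    by (simp add: Y sv_threshold_def eq svd(3) y_def[abs_def])
  have G_entry: "(X $$ (a, b) - Y $$ (a, b)) / \<tau> = dyads r (columns U) g (columns V) a b"
    if "a < m" "b < n" for a b
  proof -
    have "(X $$ (a, b) - Y $$ (a, b)) / \<tau>
        = (dyads r (columns U) (\<lambda>j. s ! j) (columns V) a b - dyads r (columns U) y (columns V) a b) / \<tau>"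
      using svd(7) that by (simp add: Y_entry)
    also have "\<dots> = dyads r (columns U) g (columns V) a b"
      unfolding dyads_def g_def sum_subtractf[symmetric] sum_divide_distrib
      by (intro sum.cong refl) (simp add: algebra_simps diff_divide_distrib)
    finally show ?thesis .
  qed
  have "entry_inner m n (\<lambda>a b. (X $$ (a, b) - Y $$ (a, b)) / \<tau>) (\<lambda>a b. Z $$ (a, b) - Y $$ (a, b))
      = entry_inner m n (dyads r (columns U) g (columns V)) (\<lambda>a b. Z $$ (a, b) - Y $$ (a, b))"
    by (rule entry_inner_cong) (simp_all add: G_entry)
  moreover have "nuclear_norm Y + entry_inner m n (dyads r (columns U) g (columns V))
      (\<lambda>a b. Z $$ (a, b) - Y $$ (a, b)) \<le> nuclear_norm Z"
  proof (rule nuclear_norm_subgradient[OF Yc Z svd(4,5) _ _ Y_entry])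
    fix j assume "j < r"
    then show "0 \<le> g j \<and> g j \<le> 1" "0 \<le> y j \<and> g j * y j = y j"
      using svd(6) \<tau> by (auto simp: g_def y_def max_def field_simps)
  qed
  ultimately show ?thesis by simp
qed

section \<open>Mode unfoldings\<close>

text \<open>A mixed-radix numeral with digits \<open>f k\<close> and bases \<open>n k\<close>. The
  positions form a set rather than an interval, because an unfolding skips its own mode.\<close>

definition radix_value :: "nat set \<Rightarrow> (nat \<Rightarrow> nat) \<Rightarrow> (nat \<Rightarrow> nat) \<Rightarrow> nat" where
  "radix_value K n f = (\<Sum>k\<in>K. f k * (\<Prod>m\<in>{m\<in>K. m < k}. n m))"

lemma radix_value_insert:
  assumes "finite K" "\<forall>a\<in>K. a < c"
  shows "radix_value (insert c K) n f = f c * prod n K + radix_value K n f"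
proof -
  have c: "c \<notin> K" using assms(2) by blast
  have "{m \<in> insert c K. m < c} = K" using assms(2) by auto
  moreover have "{m \<in> insert c K. m < k} = {m \<in> K. m < k}" if "k \<in> K" for k
    using assms(2) that by auto
  ultimately show ?thesis
    unfolding radix_value_def using assms(1) c by simp
qed

lemma radix_value_less:
  assumes "finite K" "\<forall>k\<in>K. f k < n k"
  shows "radix_value K n f < prod n K"
  using assms
proof (induction K rule: finite_linorder_max_induct)
  case empty
  then show ?case by (simp add: radix_value_def)
next
  case (insert c K)
  have "radix_value (insert c K) n f < f c * prod n K + prod n K"
    using insert radix_value_insert[of K c n f] by simp
  also have "\<dots> = Suc (f c) * prod n K" by simp
  also have "\<dots> \<le> n c * prod n K" using insert.prems by (intro mult_right_mono) auto
  also have "\<dots> = prod n (insert c K)" using insert.hyps by (subst prod.insert) auto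
  finally show ?case .
qed

text \<open>The largest position carries the leading digit, which is recovered as a quotient because
  the remaining digits amount to less than one unit of it.\<close>

lemma radix_value_inj:
  assumes "finite K" "\<forall>k\<in>K. f k < n k" "\<forall>k\<in>K. g k < n k" "radix_value K n f = radix_value K n g"
  shows "\<forall>k\<in>K. f k = g k"
  using assms
proof (induction K rule: finite_linorder_max_induct)
  case empty
  then show ?case by simp
next
  case (insert c K)
  have less: "radix_value K n f < prod n K" "radix_value K n g < prod n K"
    using insert by (auto intro!: radix_value_less)
  have eq: "f c * prod n K + radix_value K n f = g c * prod n K + radix_value K n g"
    using insert.prems(3) insert.hyps by (simp add: radix_value_insert)
  have "f c = (f c * prod n K + radix_value K n f) div prod n K"
    "g c = (g c * prod n K + radix_value K n g) div prod n K"
    using less by simp_all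
  then have fg: "f c = g c" using eq by metis
  then have "radix_value K n f = radix_value K n g" using eq by simp
  then show ?case using insert fg by simp
qed

abbreviation unfold_cols :: "nat list \<Rightarrow> nat \<Rightarrow> nat" where
  "unfold_cols d i \<equiv> \<Prod>k\<in>{..<length d} - {i}. d ! k"

lemma unfold_pos_radix: "unfold_pos d i \<iota> = (\<iota> i, radix_value ({..<length d} - {i}) (\<lambda>k. d ! k) \<iota>)"
proof -
  have "{..<k} - {i} = {m \<in> {..<length d} - {i}. m < k}" if "k < length d" for k
    using that by auto
  then show ?thesis unfolding unfold_pos_def radix_value_def by (auto intro!: sum.cong)
qed

text \<open>Injectivity is uniqueness of mixed-radix digits; surjectivity follows by
  counting.\<close>

lemma bij_betw_unfold_pos:
  assumes i: "i < length d"
  shows "bij_betw (unfold_pos d i) (indices d) ({..<d ! i} \<times> {..<unfold_cols d i})"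
proof -
  let ?K = "{..<length d} - {i}"
  have bound: "\<forall>k\<in>?K. \<iota> k < d ! k" if "\<iota> \<in> indices d" for \<iota>
    using that by (auto simp: indices_def)
  have inj: "inj_on (unfold_pos d i) (indices d)"
  proof (rule inj_onI)
    fix f g assume f: "f \<in> indices d" and g: "g \<in> indices d" and "unfold_pos d i f = unfold_pos d i g"
    then have eq: "f i = g i" "radix_value ?K (\<lambda>k. d ! k) f = radix_value ?K (\<lambda>k. d ! k) g"
      by (simp_all add: unfold_pos_radix)
    from radix_value_inj[OF _ bound[OF f] bound[OF g] eq(2)] have "\<forall>k\<in>?K. f k = g k" by simp
    then show "f = g"
      using f g eq(1) unfolding indices_def by (intro PiE_ext[of f _ _ g]) blast+
  qed
  have sub: "unfold_pos d i ` indices d \<subseteq> {..<d ! i} \<times> {..<unfold_cols d i}"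
    using i radix_value_less[OF _ bound] by (auto simp: unfold_pos_radix indices_def)
  have "card (unfold_pos d i ` indices d) = card (indices d)" by (rule card_image[OF inj])
  also have "\<dots> = (\<Prod>k<length d. d ! k)" by (simp add: indices_def card_PiE)
  also have "\<dots> = d ! i * unfold_cols d i" using i by (subst prod.remove[of _ i]) auto
  finally have "unfold_pos d i ` indices d = {..<d ! i} \<times> {..<unfold_cols d i}"
    by (intro card_subset_eq[OF _ sub]) (simp_all add: card_cartesian_product)
  with inj show ?thesis by (simp add: bij_betw_def)
qed

lemma mode_unfold_carrier: "mode_unfold d i Z \<in> carrier_mat (d ! i) (unfold_cols d i)"
  by (simp add: mode_unfold_def)

lemma mode_unfold_entry:
  assumes i: "i < length d" and \<iota>: "\<iota> \<in> indices d"
  shows "mode_unfold d i Z $$ unfold_pos d i \<iota> = Z \<iota>"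
proof -
  have "unfold_pos d i \<iota> \<in> {..<d ! i} \<times> {..<unfold_cols d i}"
    using bij_betw_apply[OF bij_betw_unfold_pos[OF i] \<iota>] .
  moreover have "inv_into (indices d) (unfold_pos d i) (unfold_pos d i \<iota>) = \<iota>"
    using bij_betw_inv_into_left[OF bij_betw_unfold_pos[OF i] \<iota>] .
  ultimately show ?thesis
    by (cases "unfold_pos d i \<iota>") (simp add: mode_unfold_def)
qed

text \<open>Unfolding only rearranges entries, so it preserves inner products and its adjoint is
  refolding.\<close>

lemma entry_inner_mode_unfold:
  assumes i: "i < length d"
  shows "entry_inner (d ! i) (unfold_cols d i) G (entries (mode_unfold d i Z))
    = tensor_inner d (\<lambda>\<iota>. if \<iota> \<in> indices d then case_prod G (unfold_pos d i \<iota>) else 0) Z"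
proof -
  have "entry_inner (d ! i) (unfold_cols d i) G (entries (mode_unfold d i Z))
      = (\<Sum>p\<in>{..<d ! i} \<times> {..<unfold_cols d i}. case_prod G p * mode_unfold d i Z $$ p)"
    unfolding entry_inner_def by (subst sum.cartesian_product) (simp add: case_prod_beta)
  also have "\<dots> = (\<Sum>\<iota>\<in>indices d. case_prod G (unfold_pos d i \<iota>) * mode_unfold d i Z $$ unfold_pos d i \<iota>)"
    by (rule sum.reindex_bij_betw[OF bij_betw_unfold_pos[OF i], symmetric])
  also have "\<dots> = (\<Sum>\<iota>\<in>indices d. case_prod G (unfold_pos d i \<iota>) * Z \<iota>)"
    by (intro sum.cong refl) (simp add: mode_unfold_entry[OF i])
  finally show ?thesis by (simp add: tensor_inner_def)
qed

lemma mode_unfold_add: "mode_unfold d i (\<lambda>\<iota>. Y \<iota> + Z \<iota>) = mode_unfold d i Y + mode_unfold d i Z"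
  by (rule eq_matI) (simp_all add: mode_unfold_def)

lemma mode_unfold_diff_entry:
  "a < d ! i \<Longrightarrow> b < unfold_cols d i \<Longrightarrow>
    mode_unfold d i (\<lambda>\<iota>. Y \<iota> - Z \<iota>) $$ (a, b) = mode_unfold d i Y $$ (a, b) - mode_unfold d i Z $$ (a, b)"
  by (simp add: mode_unfold_def)

lemma mode_refold_tensor: "mode_refold d i M \<in> tensors d"
  by (simp add: mode_refold_def tensors_def)

lemma mode_unfold_refold:
  assumes i: "i < length d" and M: "M \<in> carrier_mat (d ! i) (unfold_cols d i)"
  shows "mode_unfold d i (mode_refold d i M) = M"
proof (rule eq_matI)
  fix a b assume ab: "a < dim_row M" "b < dim_col M"
  then have "(a, b) \<in> {..<d ! i} \<times> {..<unfold_cols d i}" using M by simp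
  then obtain \<iota> where \<iota>: "\<iota> \<in> indices d" "unfold_pos d i \<iota> = (a, b)"
    using bij_betw_unfold_pos[OF i] unfolding bij_betw_def by (metis imageE)
  show "mode_unfold d i (mode_refold d i M) $$ (a, b) = M $$ (a, b)"
    using mode_unfold_entry[OF i \<iota>(1), of "mode_refold d i M"] \<iota> by (simp add: mode_refold_def)
qed (use M in \<open>simp_all add: mode_unfold_def\<close>)

definition mode_nuclear_norm :: "nat list \<Rightarrow> nat \<Rightarrow> tensor \<Rightarrow> real" where
  "mode_nuclear_norm d i Z = nuclear_norm (mode_unfold d i Z)"

lemma subgradient_of_unfolding:
  assumes i: "i < length d"
    and sub: "\<forall>W\<in>carrier_mat (d ! i) (unfold_cols d i).
      nuclear_norm (mode_unfold d i Y) + entry_inner (d ! i) (unfold_cols d i) G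
        (\<lambda>a b. W $$ (a, b) - mode_unfold d i Y $$ (a, b)) \<le> nuclear_norm W"
  shows "(\<lambda>\<iota>. if \<iota> \<in> indices d then case_prod G (unfold_pos d i \<iota>) else 0)
    \<in> subdifferential d (mode_nuclear_norm d i) Y"
proof -
  let ?H = "\<lambda>\<iota>. if \<iota> \<in> indices d then case_prod G (unfold_pos d i \<iota>) else 0"
  have "mode_nuclear_norm d i Y + tensor_inner d ?H (\<lambda>\<iota>. Z \<iota> - Y \<iota>) \<le> mode_nuclear_norm d i Z" for Z
  proof -
    have "tensor_inner d ?H (\<lambda>\<iota>. Z \<iota> - Y \<iota>)
      = entry_inner (d ! i) (unfold_cols d i) G (entries (mode_unfold d i (\<lambda>\<iota>. Z \<iota> - Y \<iota>)))"
      by (rule entry_inner_mode_unfold[OF i, symmetric])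
    also have "\<dots> = entry_inner (d ! i) (unfold_cols d i) G
        (\<lambda>a b. mode_unfold d i Z $$ (a, b) - mode_unfold d i Y $$ (a, b))"
      by (rule entry_inner_cong) (simp_all add: mode_unfold_diff_entry)
    finally show ?thesis
      using bspec[OF sub mode_unfold_carrier[of d i Z]] by (simp add: mode_nuclear_norm_def)
  qed
  then show ?thesis by (simp add: subdifferential_def tensors_def)
qed

lemma mode_nuclear_norm_add_le:
  "mode_nuclear_norm d i (\<lambda>\<iota>. Y \<iota> + Z \<iota>) \<le> mode_nuclear_norm d i Y + mode_nuclear_norm d i Z"
  unfolding mode_nuclear_norm_def mode_unfold_add
  by (rule nuclear_norm_add_le[OF mode_unfold_carrier mode_unfold_carrier])

lemma mode_nuclear_norm_subdifferentiable:
  assumes "i < length d"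
  shows "subdifferential d (mode_nuclear_norm d i) Y \<noteq> {}"
proof -
  obtain G where "\<forall>W\<in>carrier_mat (d ! i) (unfold_cols d i).
      nuclear_norm (mode_unfold d i Y) + entry_inner (d ! i) (unfold_cols d i) G
        (\<lambda>a b. W $$ (a, b) - mode_unfold d i Y $$ (a, b)) \<le> nuclear_norm W"
    using nuclear_norm_subdifferentiable[OF mode_unfold_carrier[of d i Y]] by blast
  then show ?thesis using subgradient_of_unfolding[OF assms] by blast
qed

text \<open>With threshold 1 / c the subgradient is c times the thresholding residual; the shift of
  the argument by \<open>L\<close> divided by c then contributes the term
  \<open>- L\<close>.\<close>

lemma threshold_step_subgradient:
  assumes i: "i < length d" and c: "c > 0" and X: "X \<in> tensors d" and L: "L \<in> tensors d"
    and Y: "Y = mode_refold d i (sv_threshold (1 / c) (mode_unfold d i X - (1 / c) \<cdot>\<^sub>m mode_unfold d i L))"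
  shows "(\<lambda>\<iota>. c * (X \<iota> - Y \<iota>) - L \<iota>) \<in> subdifferential d (mode_nuclear_norm d i) Y"
proof -
  define W where "W = mode_unfold d i X - (1 / c) \<cdot>\<^sub>m mode_unfold d i L"
  define G where "G a b = (W $$ (a, b) - sv_threshold (1 / c) W $$ (a, b)) / (1 / c)" for a b
  have W: "W \<in> carrier_mat (d ! i) (unfold_cols d i)"
    unfolding W_def by (simp add: minus_carrier_mat mode_unfold_carrier)
  have YW: "mode_unfold d i Y = sv_threshold (1 / c) W"
    unfolding Y W_def[symmetric] by (rule mode_unfold_refold[OF i sv_threshold_carrier[OF W]])
  have YT: "Y \<in> tensors d" unfolding Y by (rule mode_refold_tensor)
  have "(\<lambda>\<iota>. if \<iota> \<in> indices d then case_prod G (unfold_pos d i \<iota>) else 0)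
    \<in> subdifferential d (mode_nuclear_norm d i) Y"
  proof (rule subgradient_of_unfolding[OF i], rule ballI)
    fix Z :: "real mat" assume Z: "Z \<in> carrier_mat (d ! i) (unfold_cols d i)"
    show "nuclear_norm (mode_unfold d i Y) + entry_inner (d ! i) (unfold_cols d i) G
        (\<lambda>a b. Z $$ (a, b) - mode_unfold d i Y $$ (a, b)) \<le> nuclear_norm Z"
      using sv_threshold_subgradient[OF W Z, of "1 / c"] c
      unfolding YW G_def by simp
  qed
  also have "(\<lambda>\<iota>. if \<iota> \<in> indices d then case_prod G (unfold_pos d i \<iota>) else 0)
    = (\<lambda>\<iota>. c * (X \<iota> - Y \<iota>) - L \<iota>)"
  proof
    fix \<iota>
    show "(if \<iota> \<in> indices d then case_prod G (unfold_pos d i \<iota>) else 0) = c * (X \<iota> - Y \<iota>) - L \<iota>"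
    proof (cases "\<iota> \<in> indices d")
      case True
      obtain a b where ab: "unfold_pos d i \<iota> = (a, b)" by (cases "unfold_pos d i \<iota>")
      have "a < d ! i" "b < unfold_cols d i"
        using bij_betw_apply[OF bij_betw_unfold_pos[OF i] True] by (auto simp: ab)
      then have "W $$ (a, b) = X \<iota> - (1 / c) * L \<iota>"
        using mode_unfold_entry[OF i True, of X] mode_unfold_entry[OF i True, of L]
          mode_unfold_carrier[of d i X] mode_unfold_carrier[of d i L]
        by (simp add: W_def ab)
      moreover have "sv_threshold (1 / c) W $$ (a, b) = Y \<iota>"
        using mode_unfold_entry[OF i True, of Y] by (simp add: YW ab)
      ultimately show ?thesis using True c by (simp add: ab G_def field_simps)
    next
      \<comment> \<open>All three tensors vanish here, so the two sides agree as functions and not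
        only on the index set.\<close>
      case False
      then show ?thesis using X L YT by (simp add: tensors_def)
    qed
  qed
  finally show ?thesis .
qed

section \<open>Projection and convergence of SALM\<close>

definition convex_tensors :: "tensor set \<Rightarrow> bool" where
  "convex_tensors B \<longleftrightarrow>
     (\<forall>X\<in>B. \<forall>Y\<in>B. \<forall>t. 0 \<le> t \<and> t \<le> 1 \<longrightarrow> (\<lambda>\<iota>. X \<iota> + t * (Y \<iota> - X \<iota>)) \<in> B)"

lemma frob_norm_le_iff: "frob_norm d Y \<le> frob_norm d Z \<longleftrightarrow> tensor_inner d Y Y \<le> tensor_inner d Z Z"
  by (simp add: frob_norm_def)

lemma abs_entry_le_frob_norm:
  assumes "\<iota> \<in> indices d"
  shows "\<bar>Z \<iota>\<bar> \<le> frob_norm d Z"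
proof -
  have "Z \<iota> * Z \<iota> \<le> tensor_inner d Z Z"
    unfolding tensor_inner_def using assms finite_indices by (intro member_le_sum) auto
  then have "sqrt (Z \<iota> * Z \<iota>) \<le> frob_norm d Z" unfolding frob_norm_def by (rule real_sqrt_le_mono)
  then show ?thesis by simp
qed

lemma continuous_on_entry: "continuous_on S (\<lambda>X :: 'a \<Rightarrow> real. X \<iota>)"
  by (rule continuous_on_product_then_coordinatewise[OF continuous_on_id])

text \<open>\<open>frob_proj\<close> is a choice among minimizers, so existence has to be shown. The
  set may be unbounded; points at least as close to \<open>Z\<close> as some \<open>X0\<close> lie
  in a compact box, which suffices.\<close>

lemma projection_minimizes:
  assumes B: "closed B" "B \<noteq> {}" "B \<subseteq> tensors d"
  shows "frob_proj d B Z \<in> B"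
    "\<And>X. X \<in> B \<Longrightarrow> frob_norm d (\<lambda>\<iota>. Z \<iota> - frob_proj d B Z \<iota>) \<le> frob_norm d (\<lambda>\<iota>. Z \<iota> - X \<iota>)"
proof -
  let ?f = "\<lambda>X. frob_norm d (\<lambda>\<iota>. Z \<iota> - X \<iota>)"
  obtain X0 where X0: "X0 \<in> B" using B(2) by blast
  define S where "S = B \<inter> {X. \<forall>\<iota>. \<bar>X \<iota>\<bar> \<le> (if \<iota> \<in> indices d then \<bar>Z \<iota>\<bar> + ?f X0 else 0)}"
  have "compact S" unfolding S_def by (rule closed_Int_compact[OF B(1) compact_coordinate_box])
  moreover have in_S: "X \<in> S" if X: "X \<in> B" and le: "?f X \<le> ?f X0" for X
  proof -
    have "\<bar>X \<iota>\<bar> \<le> \<bar>Z \<iota>\<bar> + ?f X0" if "\<iota> \<in> indices d" for \<iota>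
      using abs_entry_le_frob_norm[OF that, of "\<lambda>\<iota>. Z \<iota> - X \<iota>"] le by simp
    moreover have "X \<iota> = 0" if "\<iota> \<notin> indices d" for \<iota>
      using X B(3) that by (auto simp: tensors_def)
    ultimately show ?thesis using X by (simp add: S_def)
  qed
  moreover have "continuous_on S ?f"
    unfolding frob_norm_def tensor_inner_def
    by (intro continuous_on_real_sqrt continuous_on_sum continuous_on_mult continuous_on_diff
        continuous_on_const continuous_on_entry)
  ultimately obtain P where P: "P \<in> S" "\<forall>X\<in>S. ?f P \<le> ?f X"
    using continuous_attains_inf[of S ?f] X0 by blast
  have min: "?f P \<le> ?f X" if "X \<in> B" for X
  proof (cases "?f X \<le> ?f X0")
    case True
    then show ?thesis using P in_S[OF that] by blast
  next
    case False
    then show ?thesis using P in_S[OF X0] by force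
  qed
  have "P \<in> B" using P by (simp add: S_def)
  then have "frob_proj d B Z \<in> B \<and> (\<forall>X\<in>B. ?f (frob_proj d B Z) \<le> ?f X)"
    unfolding frob_proj_def arg_min_on_def
    by (rule arg_minI[where Q = "\<lambda>x. x \<in> B \<and> (\<forall>X\<in>B. ?f x \<le> ?f X)"]) (use min in \<open>auto simp: not_less\<close>)
  then show "frob_proj d B Z \<in> B" "\<And>X. X \<in> B \<Longrightarrow> ?f (frob_proj d B Z) \<le> ?f X"
    by auto
qed

text \<open>First-order optimality along the segment from the projection to \<open>X\<close>: the
  quadratic in t is divided by t, and t is made small.\<close>

lemma projection_variational:
  assumes B: "closed B" "B \<noteq> {}" "B \<subseteq> tensors d" "convex_tensors B" and X: "X \<in> B"
  shows "tensor_inner d (\<lambda>\<iota>. Z \<iota> - frob_proj d B Z \<iota>) (\<lambda>\<iota>. X \<iota> - frob_proj d B Z \<iota>) \<le> 0"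
proof -
  define P where "P = frob_proj d B Z"
  have P: "P \<in> B" unfolding P_def by (rule projection_minimizes(1)[OF B(1-3)])
  define q where "q = tensor_inner d (\<lambda>\<iota>. Z \<iota> - P \<iota>) (\<lambda>\<iota>. X \<iota> - P \<iota>)"
  define w where "w = tensor_inner d (\<lambda>\<iota>. X \<iota> - P \<iota>) (\<lambda>\<iota>. X \<iota> - P \<iota>)"
  have w: "w \<ge> 0" unfolding w_def tensor_inner_def by (intro sum_nonneg) auto
  have le: "2 * q \<le> t * w" if t: "0 < t" "t \<le> 1" for t
  proof -
    have "(\<lambda>\<iota>. P \<iota> + t * (X \<iota> - P \<iota>)) \<in> B" using B(4) P X t by (simp add: convex_tensors_def)
    from projection_minimizes(2)[OF B(1-3) this, of Z]
    have "tensor_inner d (\<lambda>\<iota>. Z \<iota> - P \<iota>) (\<lambda>\<iota>. Z \<iota> - P \<iota>)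
      \<le> tensor_inner d (\<lambda>\<iota>. Z \<iota> - (P \<iota> + t * (X \<iota> - P \<iota>))) (\<lambda>\<iota>. Z \<iota> - (P \<iota> + t * (X \<iota> - P \<iota>)))"
      unfolding frob_norm_le_iff P_def .
    also have "\<dots> = tensor_inner d (\<lambda>\<iota>. Z \<iota> - P \<iota>) (\<lambda>\<iota>. Z \<iota> - P \<iota>) - 2 * t * q + t * t * w"
      unfolding q_def w_def tensor_inner_def
      by (simp add: sum_distrib_left sum_subtractf[symmetric] sum.distrib[symmetric] algebra_simps)
    finally have "t * (2 * q) \<le> t * (t * w)" by (simp add: algebra_simps)
    then show ?thesis using t(1) by simp
  qed
  have "q \<le> 0"
  proof (rule ccontr)
    assume "\<not> q \<le> 0"
    then have q: "q > 0" by simp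
    \<comment> \<open>This t gives a right-hand side of at most \<open>q\<close>; the summand 1
      guards against \<open>w = 0\<close>.\<close>
    have "2 * q \<le> min 1 (q / (w + 1)) * w" by (rule le) (use q w in auto)
    also have "\<dots> \<le> q / (w + 1) * w" using w by (intro mult_right_mono) auto
    also have "\<dots> \<le> q" using q w by (simp add: field_simps)
    finally show False using q by simp
  qed
  then show ?thesis by (simp add: q_def P_def)
qed

definition unit_tensor :: "(nat \<Rightarrow> nat) \<Rightarrow> tensor" where
  "unit_tensor \<kappa> = (\<lambda>\<iota>. if \<iota> = \<kappa> then 1 else 0)"

text \<open>By induction on the support, \<open>A\<close> is determined by its values at unit
  tensors. This presents the solution set by finite sums of entries, from which closedness and
  convexity can be read off.\<close>

lemma tensor_linear_entry:
  assumes A: "tensor_linear d p A" and Z: "Z \<in> tensors d" and j: "j < p"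
  shows "A Z $ j = (\<Sum>\<kappa>\<in>indices d. Z \<kappa> * A (unit_tensor \<kappa>) $ j)"
proof -
  have carrier: "A W \<in> carrier_vec p" if "W \<in> tensors d" for W
    using A that by (simp add: tensor_linear_def)
  have add: "A (\<lambda>\<iota>. V \<iota> + W \<iota>) = A V + A W" if "V \<in> tensors d" "W \<in> tensors d" for V W
    using A that by (simp add: tensor_linear_def)
  have scale: "A (\<lambda>\<iota>. c * W \<iota>) = c \<cdot>\<^sub>v A W" if "W \<in> tensors d" for c W
    using A that by (simp add: tensor_linear_def)
  have "A (\<lambda>\<iota>. if \<iota> \<in> S then Z \<iota> else 0) $ j = (\<Sum>\<kappa>\<in>S. Z \<kappa> * A (unit_tensor \<kappa>) $ j)"
    if "finite S" "S \<subseteq> indices d" for S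
    using that
  proof (induction S)
    case empty
    have zero: "(\<lambda>\<iota>. 0) \<in> tensors d" by (simp add: tensors_def)
    have "A (\<lambda>\<iota>. 0) = 0 \<cdot>\<^sub>v A (\<lambda>\<iota>. 0)" using scale[OF zero, of 0] by simp
    then have "A (\<lambda>\<iota>. 0) $ j = (0 \<cdot>\<^sub>v A (\<lambda>\<iota>. 0)) $ j" by (rule arg_cong)
    then show ?case using carrier[OF zero] j by simp
  next
    case (insert \<kappa> S)
    have T: "(\<lambda>\<iota>. if \<iota> \<in> S then Z \<iota> else 0) \<in> tensors d" using Z by (simp add: tensors_def)
    have e: "unit_tensor \<kappa> \<in> tensors d" using insert.prems by (auto simp: tensors_def unit_tensor_def)
    have se: "(\<lambda>\<iota>. Z \<kappa> * unit_tensor \<kappa> \<iota>) \<in> tensors d" by (rule tensors_closed_under(4)[OF e])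
    have "(\<lambda>\<iota>. if \<iota> \<in> insert \<kappa> S then Z \<iota> else 0)
      = (\<lambda>\<iota>. (if \<iota> \<in> S then Z \<iota> else 0) + Z \<kappa> * unit_tensor \<kappa> \<iota>)"
      using insert.hyps by (auto simp: unit_tensor_def)
    moreover have "A (\<lambda>\<iota>. (if \<iota> \<in> S then Z \<iota> else 0) + Z \<kappa> * unit_tensor \<kappa> \<iota>)
      = A (\<lambda>\<iota>. if \<iota> \<in> S then Z \<iota> else 0) + A (\<lambda>\<iota>. Z \<kappa> * unit_tensor \<kappa> \<iota>)"
      by (rule add[OF T se])
    moreover have "A (\<lambda>\<iota>. Z \<kappa> * unit_tensor \<kappa> \<iota>) = Z \<kappa> \<cdot>\<^sub>v A (unit_tensor \<kappa>)"
      by (rule scale[OF e])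
    ultimately show ?case
      using insert carrier[OF T] carrier[OF e] j by simp
  qed
  from this[OF finite_indices subset_refl]
  have "A (\<lambda>\<iota>. if \<iota> \<in> indices d then Z \<iota> else 0) $ j = (\<Sum>\<kappa>\<in>indices d. Z \<kappa> * A (unit_tensor \<kappa>) $ j)" .
  moreover have "(\<lambda>\<iota>. if \<iota> \<in> indices d then Z \<iota> else 0) = Z" using Z by (auto simp: tensors_def)
  ultimately show ?thesis by simp
qed

lemma solution_set_equations:
  assumes A: "tensor_linear d p A" and b: "b \<in> carrier_vec p"
  shows "solution_set d A b = {X. (\<forall>\<iota>\<in>- indices d. X \<iota> = 0) \<and>
    (\<forall>j\<in>{..<p}. (\<Sum>\<kappa>\<in>indices d. X \<kappa> * A (unit_tensor \<kappa>) $ j) = b $ j)}"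
proof -
  have "A X = b \<longleftrightarrow> (\<forall>j\<in>{..<p}. (\<Sum>\<kappa>\<in>indices d. X \<kappa> * A (unit_tensor \<kappa>) $ j) = b $ j)"
    if X: "X \<in> tensors d" for X
  proof -
    have "A X \<in> carrier_vec p" using A X by (simp add: tensor_linear_def)
    then show ?thesis
      using b tensor_linear_entry[OF A X] by (auto simp: vec_eq_iff)
  qed
  then show ?thesis by (auto simp: solution_set_def tensors_def)
qed

lemma closed_solution_set:
  assumes "tensor_linear d p A" "b \<in> carrier_vec p"
  shows "closed (solution_set d A b)"
proof -
  have "solution_set d A b = (\<Inter>\<iota>\<in>- indices d. {X. X \<iota> = 0}) \<inter>
    (\<Inter>j\<in>{..<p}. {X. (\<Sum>\<kappa>\<in>indices d. X \<kappa> * A (unit_tensor \<kappa>) $ j) = b $ j})"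
    unfolding solution_set_equations[OF assms] by blast
  also have "closed \<dots>"
    by (intro closed_Int closed_INT ballI closed_Collect_eq continuous_on_sum continuous_on_mult
        continuous_on_const continuous_on_entry)
  finally show ?thesis .
qed

lemma convex_solution_set:
  assumes "tensor_linear d p A" "b \<in> carrier_vec p"
  shows "convex_tensors (solution_set d A b)"
  unfolding convex_tensors_def solution_set_equations[OF assms]
  by (auto simp: algebra_simps sum.distrib sum_subtractf sum_distrib_left[symmetric])

text \<open>When the subgradient inequalities are summed, the linear terms combine into the
  functional of the summed multipliers, whose sign the normal cone fixes.\<close>

lemma kkt_point_minimizes:
  assumes "kkt_point d B h X L" "Z \<in> B" "B \<subseteq> tensors d"
  shows "(\<Sum>i<length d. h i X) \<le> (\<Sum>i<length d. h i Z)"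
proof -
  have Z: "Z \<in> tensors d" using assms by blast
  have "h i X + tensor_inner d (\<lambda>\<iota>. - L i \<iota>) (\<lambda>\<iota>. Z \<iota> - X \<iota>) \<le> h i Z" if "i < length d" for i
    using assms(1) that Z by (simp add: kkt_point_def subdifferential_def)
  then have "(\<Sum>i<length d. h i X - tensor_inner d (L i) (\<lambda>\<iota>. Z \<iota> - X \<iota>)) \<le> (\<Sum>i<length d. h i Z)"
    by (intro sum_mono) (simp add: tensor_inner_minus_left)
  moreover have "tensor_inner d (\<lambda>\<iota>. \<Sum>i<length d. L i \<iota>) (\<lambda>\<iota>. Z \<iota> - X \<iota>) \<le> 0"
    using assms(1,2) by (auto simp: kkt_point_def normal_cone_def)
  ultimately show ?thesis by (simp add: tensor_inner_sum_left sum_subtractf)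
qed

lemma nuclear_objective_consensus:
  assumes "\<forall>i<length d. Y i = X"
  shows "nuclear_objective d Y = (\<Sum>i<length d. mode_nuclear_norm d i X)"
  using assms by (simp add: nuclear_objective_def mode_nuclear_norm_def)

lemma kkt_point_optimal:
  assumes kkt: "kkt_point d (solution_set d A b) (mode_nuclear_norm d) X L"
  shows "optimal_P d A b X (\<lambda>_. X)" "optimal_constrained d A b X (\<lambda>_. X)"
proof -
  let ?B = "solution_set d A b"
  have sub: "?B \<subseteq> tensors d" by (auto simp: solution_set_def)
  have X: "X \<in> ?B" "X \<in> tensors d" using kkt sub by (auto simp: kkt_point_def)
  have min: "nuclear_objective d (\<lambda>_. X) \<le> nuclear_objective d Y'"
    if "X' \<in> ?B" "\<forall>i<length d. Y' i = X'" for X' Y'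
    using kkt_point_minimizes[OF kkt that(1) sub] nuclear_objective_consensus[OF that(2)]
      nuclear_objective_consensus[of d "\<lambda>_. X" X] by simp
  show "optimal_constrained d A b X (\<lambda>_. X)"
    unfolding optimal_constrained_def is_arg_min_def using X min by (auto simp: not_less)
  show "optimal_P d A b X (\<lambda>_. X)"
    unfolding optimal_P_def is_arg_min_def
    using X min by (auto simp: not_less constraint_indicator_def)
qed

lemma admm_if_SALM:
  assumes "d \<noteq> []" and A: "tensor_linear d p A" and b: "b \<in> carrier_vec p"
    and \<beta>: "\<forall>k. \<beta> k > 0" "incseq \<beta>" "filterlim (\<lambda>K. \<Sum>k<K. 1 / \<beta> k) at_top sequentially"
    and S: "SALM d A b \<beta> X Y \<Lambda>" and ne: "solution_set d A b \<noteq> {}"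
  shows "admm d (solution_set d A b) (mode_nuclear_norm d) \<beta> X Y \<Lambda>"
proof -
  let ?B = "solution_set d A b"
  have sub: "?B \<subseteq> tensors d" by (auto simp: solution_set_def)
  have closed: "closed ?B" by (rule closed_solution_set[OF A b])
  have convex: "convex_tensors ?B" by (rule convex_solution_set[OF A b])
  define W where "W k \<iota> = 1 / (real (length d) * \<beta> k) *
    ((\<Sum>i<length d. \<Lambda> k i \<iota>) + (\<Sum>i<length d. \<beta> k * Y k i \<iota>))" for k \<iota>
  have XS: "X (Suc k) = frob_proj d ?B (W k)" for k
    using S by (simp add: SALM_def W_def[abs_def])
  have X_B: "X (Suc k) \<in> ?B" for k
    unfolding XS by (rule projection_minimizes(1)[OF closed ne sub])
  then have X_T: "X (Suc k) \<in> tensors d" for k using sub by blast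
  have YS: "Y (Suc k) i = mode_refold d i (sv_threshold (1 / \<beta> k)
      (mode_unfold d i (X (Suc k)) - (1 / \<beta> k) \<cdot>\<^sub>m mode_unfold d i (\<Lambda> k i)))"
    if "i < length d" for k i
    using S that by (simp add: SALM_def)
  have LS: "\<Lambda> (Suc k) i = (\<lambda>\<iota>. \<Lambda> k i \<iota> - \<beta> k * (X (Suc k) \<iota> - Y (Suc k) i \<iota>))"
    if "i < length d" for k i
    using S that unfolding SALM_def by blast
  have Y_T: "Y k i \<in> tensors d" if "i < length d" for k i
    using S that by (cases k) (simp_all add: SALM_def YS mode_refold_tensor)
  have L_T: "\<Lambda> k i \<in> tensors d" if "i < length d" for k i
  proof (induction k)
    case 0
    then show ?case using S that by (simp add: SALM_def)
  next
    case (Suc k)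
    then show ?case unfolding LS[OF that]
      by (intro tensors_closed_under X_T Y_T[OF that])
  qed
  show ?thesis
  proof
    show "closed ?B" "?B \<subseteq> tensors d" by fact+
    show "mode_nuclear_norm d i (\<lambda>\<iota>. Y \<iota> + Z \<iota>) \<le> mode_nuclear_norm d i Y + mode_nuclear_norm d i Z"
      for i Y Z by (rule mode_nuclear_norm_add_le)
    show "subdifferential d (mode_nuclear_norm d i) Y \<noteq> {}" if "i < length d" for i Y
      by (rule mode_nuclear_norm_subdifferentiable[OF that])
    show "0 < \<beta> k" for k using \<beta>(1) by blast
    show "incseq \<beta>" "filterlim (\<lambda>K. \<Sum>k<K. 1 / \<beta> k) at_top sequentially" by fact+
    show "Y k i \<in> tensors d" if "i < length d" for k i by (rule Y_T[OF that])
    show "\<Lambda> (Suc k) i \<iota> = \<Lambda> k i \<iota> - \<beta> k * (X (Suc k) \<iota> - Y (Suc k) i \<iota>)"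
      if "i < length d" for k i \<iota>
      using LS[OF that] by simp
    show "(\<lambda>\<iota>. - \<Lambda> (Suc k) i \<iota>) \<in> subdifferential d (mode_nuclear_norm d i) (Y (Suc k) i)"
      if i: "i < length d" for k i
    proof -
      have "0 < \<beta> k" using \<beta>(1) by blast
      from threshold_step_subgradient[OF i this X_T L_T[OF i] YS[OF i]]
      show ?thesis by (simp add: LS[OF i])
    qed
    show "(\<lambda>\<iota>. \<Sum>i<length d. \<Lambda> k i \<iota> + \<beta> k * (Y k i \<iota> - X (Suc k) \<iota>)) \<in> normal_cone d ?B (X (Suc k))"
      (is "?H \<in> _") for k
    proof -
      define c where "c = real (length d) * \<beta> k"
      have c: "c > 0" using \<beta>(1) assms(1) by (simp add: c_def)
      \<comment> \<open>The argument of the projection is the average of \<open>Y k i\<close> plus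
        \<open>\<Lambda> k i\<close> over \<beta>, so scaling the projection residual by c recovers
        the sum over all modes.\<close>
      have H: "?H \<iota> = c * (W k \<iota> - X (Suc k) \<iota>)" for \<iota>
      proof -
        have "c * W k \<iota> = (\<Sum>i<length d. \<Lambda> k i \<iota>) + (\<Sum>i<length d. \<beta> k * Y k i \<iota>)"
          using c by (simp add: W_def c_def[symmetric])
        then show ?thesis
          by (simp add: sum.distrib sum_subtractf right_diff_distrib c_def)
      qed
      have "tensor_inner d ?H (\<lambda>\<iota>. X' \<iota> - X (Suc k) \<iota>) \<le> 0" if "X' \<in> ?B" for X'
      proof -
        have "tensor_inner d ?H (\<lambda>\<iota>. X' \<iota> - X (Suc k) \<iota>)
          = c * tensor_inner d (\<lambda>\<iota>. W k \<iota> - X (Suc k) \<iota>) (\<lambda>\<iota>. X' \<iota> - X (Suc k) \<iota>)"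
          unfolding H tensor_inner_def by (simp add: sum_distrib_left mult.assoc)
        also have "\<dots> \<le> 0"
          using projection_variational[OF closed ne sub convex that, of "W k"] c
          unfolding XS by (simp add: mult_nonneg_nonpos)
        finally show ?thesis .
      qed
      moreover have "?H \<in> tensors d"
        by (intro tensors_closed_under X_T) (simp_all add: Y_T L_T)
      ultimately show ?thesis using X_B by (simp add: normal_cone_def)
    qed
  qed
qed

theorem theorem5p1:
  fixes d :: "nat list" and p :: nat
    and A :: "tensor \<Rightarrow> real vec" and b :: "real vec"
    and \<beta> :: "nat \<Rightarrow> real"
    and X :: "nat \<Rightarrow> tensor" and Y \<Lambda> :: "nat \<Rightarrow> nat \<Rightarrow> tensor"
  assumes "d \<noteq> []" and "\<forall>n\<in>set d. n \<ge> 1"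
    and "p \<le> prod_list d" and "tensor_linear d p A" and "b \<in> carrier_vec p"
    and "\<forall>k. \<beta> k > 0" and "incseq \<beta>"
    and "filterlim (\<lambda>K. \<Sum>k<K. 1 / \<beta> k) at_top sequentially"
    and "SALM d A b \<beta> X Y \<Lambda>"
    and "\<exists>Xs Ys \<Lambda>s. KKT d A b Xs Ys \<Lambda>s"
  shows "\<exists>Xs Ys. tensor_tendsto d X Xs \<and>
           (\<forall>i<length d. tensor_tendsto d (\<lambda>k. Y k i) (Ys i)) \<and>
           optimal_P d A b Xs Ys \<and> optimal_constrained d A b Xs Ys"
proof -
  obtain Xs Ys \<Lambda>s where KKT: "KKT d A b Xs Ys \<Lambda>s" using assms(10) by blast
  then have kkt: "kkt_point d (solution_set d A b) (mode_nuclear_norm d) Xs \<Lambda>s"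
    unfolding KKT_def kkt_point_def mode_nuclear_norm_def[abs_def] by simp
  \<comment> \<open>Solvability of the optimality system makes the solution set nonempty, without
    which the projection would be unspecified.\<close>
  then have ne: "solution_set d A b \<noteq> {}" by (auto simp: kkt_point_def)
  interpret admm d "solution_set d A b" "mode_nuclear_norm d" \<beta> X Y \<Lambda>
    by (rule admm_if_SALM[OF assms(1,4-9) ne])
  obtain Xi Li where kkt': "kkt_point d (solution_set d A b) (mode_nuclear_norm d) Xi Li"
    and X: "\<forall>\<iota>\<in>indices d. (\<lambda>k. X k \<iota>) \<longlonglongrightarrow> Xi \<iota>"
    and Y: "\<forall>i<length d. \<forall>\<iota>\<in>indices d. (\<lambda>k. Y k i \<iota>) \<longlonglongrightarrow> Xi \<iota>"
    using iterates_converge[OF assms(1) kkt] by blast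
  have "tensor_tendsto d X Xi" by (rule tensor_tendsto_pointwise) (use X in blast)
  moreover have "tensor_tendsto d (\<lambda>k. Y k i) Xi" if "i < length d" for i
    by (rule tensor_tendsto_pointwise) (use Y that in blast)
  ultimately show ?thesis
    using kkt_point_optimal[OF kkt'] by (intro exI[of _ Xi] exI[of _ "\<lambda>_. Xi"]) simp
qed

end
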